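(* Let $\Bbbk\in\{\mathbb{R},\mathbb{C}\}$, let $\mathcal{X}\subseteq\Bbbk^n$ be a model with $d=\dim\mathcal{X}$, and let $\mu:\mathcal{X}\to\Bbbk^s$ be the restriction to $\mathcal{X}$ of a polynomial map $\Bbbk^n\to\Bbbk^s$ (also denoted $\mu$). (1) Suppose $\mathcal{X}=\{x\in\Bbbk^n:f_1(x)=\cdots=f_k(x)=0\}$ is irreducible, where $f_1,\dots,f_k\in\Bbbk[x_1,\dots,x_n]$, and write $f=(f_1,\dots,f_k):\Bbbk^n\to\Bbbk^k$. If there exists a point $x\in\mathcal{X}$ with $$\ker(\mathrm{d}_x\mu)\cap\ker(\mathrm{d}_xf)=0$$ (equivalently, the $(s+k)\times n$ matrix obtained by stacking the Jacobian matrices $\mathrm{d}_x\mu\in\Bbbk^{s\times n}$ and $\mathrm{d}_xf\in\Bbbk^{k\times n}$ has rank $n$), then $\mu$ is generically recoverable. (2) Suppose $\mathcal{X}=\phi(\Bbbk^\ell)$ for a polynomial map $\phi=(\phi_1,\dots,\phi_n):\Bbbk^\ell\to\Bbbk^n$. If there exists a point $t\in\Bbbk^\ell$ such that the Jacobian matrix of $\mu\circ\phi:\Bbbk^\ell\to\Bbbk^s$ at $t$ has rank $d$, then $\mu$ is generically recoverable.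
   Context: A variety is irreducible if it is nonempty and not a union of two proper algebraic subvarieties. $\overline{\mathcal{X}}$ is the Zariski closure of $\mathcal{X}$ in $\Bbbk^n$, and $\dim\mathcal{X}=\dim\overline{\mathcal X}$ is its dimension as an algebraic variety over $\Bbbk$ (in case (2): the maximal rank of the Jacobian matrix of $\phi$ over $\Bbbk^\ell$). $\mathrm{d}_xg$ denotes the differential (Jacobian matrix) of a polynomial map $g$ at $x$. The map $\mu$ is recoverable at $x\in\mathcal{X}$ if the fiber $\mu^{-1}(\mu(x))\subseteq\mathcal X$ is finite; it is generically recoverable if it is recoverable at all $x\in\mathcal{X}\cap U$ for some nonempty Zariski open subset $U$ of $\overline{\mathcal{X}}$. $s\ge1$ is an integer. *)

theory Defs
  imports "HOL-Analysis.Analysis" "HOL-Library.Extended_Nat"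
begin

(* The ground field is a type of class real_normed_field. Both real and complex are instances;
   conversely, the norm being multiplicative, the Gelfand-Mazur theorem shows that every such
   field is isometrically isomorphic to one of these two. The fields being infinite, polynomials
   are identified with polynomial functions. *)

definition polynomial_fun :: "('k::real_normed_field ^ 'n \<Rightarrow> 'k) \<Rightarrow> bool" where
  "polynomial_fun p \<longleftrightarrow>
     (\<exists>(A :: ('n \<Rightarrow> nat) set) c. finite A \<and> p = (\<lambda>x. \<Sum>a\<in>A. c a * (\<Prod>i\<in>UNIV. x $ i ^ a i)))"

definition polynomial_map :: "('k::real_normed_field ^ 'n \<Rightarrow> 'k ^ 'm) \<Rightarrow> bool" where
  "polynomial_map g \<longleftrightarrow> (\<forall>j. polynomial_fun (\<lambda>x. g x $ j))"

(* The family P may be infinite; by Hilbert's basis theorem this gives the same sets. *)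
definition algebraic_set :: "('k::real_normed_field ^ 'n) set \<Rightarrow> bool" where
  "algebraic_set V \<longleftrightarrow> (\<exists>P. (\<forall>p\<in>P. polynomial_fun p) \<and> V = {x. \<forall>p\<in>P. p x = 0})"

definition zariski_closure :: "('k::real_normed_field ^ 'n) set \<Rightarrow> ('k ^ 'n) set" where
  "zariski_closure X = algebraic_set hull X"

definition zariski_open_in :: "('k::real_normed_field ^ 'n) set \<Rightarrow> ('k ^ 'n) set \<Rightarrow> bool" where
  "zariski_open_in V U \<longleftrightarrow> (\<exists>Z. algebraic_set Z \<and> U = V - Z)"

definition irreducible_variety :: "('k::real_normed_field ^ 'n) set \<Rightarrow> bool" where
  "irreducible_variety V \<longleftrightarrow>
     algebraic_set V \<and> V \<noteq> {} \<and>
     \<not> (\<exists>A B. algebraic_set A \<and> algebraic_set B \<and> A \<subset> V \<and> B \<subset> V \<and> V = A \<union> B)"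

(* Krull dimension of the Zariski closure: the supremum of the lengths m of chains
   C 0 < C 1 < ... < C m of irreducible subvarieties. (The empty set gets the value 0.) *)
definition variety_dim :: "('k::real_normed_field ^ 'n) set \<Rightarrow> enat" where
  "variety_dim X =
     Sup {enat m | m. \<exists>C :: nat \<Rightarrow> ('k ^ 'n) set.
            (\<forall>i\<le>m. irreducible_variety (C i)) \<and> (\<forall>i<m. C i \<subset> C (Suc i)) \<and>
            C m \<subseteq> zariski_closure X}"

(* For a polynomial map over the complex numbers the library's jacobian is still the matrix of
   complex partial derivatives: the real Frechet derivative is then complex linear, and its
   value at axis j 1 is the j-th complex partial derivative. *)
definition ker_differential :: "('k::real_normed_field ^ 'n \<Rightarrow> 'k ^ 'm) \<Rightarrow> 'k ^ 'n \<Rightarrow> ('k ^ 'n) set" where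
  "ker_differential g x = {v. jacobian g (at x) *v v = 0}"

definition stack_matrix :: "'k ^ 'n ^ 's \<Rightarrow> 'k ^ 'n ^ 'm \<Rightarrow> 'k ^ 'n ^ ('s + 'm)" where
  "stack_matrix A B = (\<chi> r. case r of Inl i \<Rightarrow> A $ i | Inr j \<Rightarrow> B $ j)"

definition recoverable_at ::
    "('k::real_normed_field ^ 'n \<Rightarrow> 'k ^ 's) \<Rightarrow> ('k ^ 'n) set \<Rightarrow> 'k ^ 'n \<Rightarrow> bool" where
  "recoverable_at \<mu> X x \<longleftrightarrow> finite {z \<in> X. \<mu> z = \<mu> x}"

definition generically_recoverable ::
    "('k::real_normed_field ^ 'n \<Rightarrow> 'k ^ 's) \<Rightarrow> ('k ^ 'n) set \<Rightarrow> bool" where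
  "generically_recoverable \<mu> X \<longleftrightarrow>
     (\<exists>U. zariski_open_in (zariski_closure X) U \<and> U \<noteq> {} \<and> (\<forall>x \<in> X \<inter> U. recoverable_at \<mu> X x))"

end

theory Submission
  imports Defs "HOL-Library.Function_Algebras" "HOL-Computational_Algebra.Polynomial"
begin

text \<open>
Fix a parametrization \<open>\<phi> : Y \<rightarrow> X\<close>: it is the identity of \<open>Y = X\<close> when \<open>X\<close> is given by
equations, and the given map on \<open>Y = k^l\<close>. In both cases the polynomial functions on \<open>Y\<close> form an integral domain. The theorem
follows once every coordinate of \<open>\<phi>\<close> satisfies a nontrivial polynomial equation on \<open>Y\<close> whose
coefficients are polynomials in \<open>\<mu> \<circ> \<phi>\<close>: along a fibre of \<open>\<mu>\<close> these coefficients are constant, and as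
long as the equations do not degenerate, which is a nonempty open condition, every coordinate of a point
of the fibre is one of finitely many roots (\<open>generically_recoverableI\<close>).

Algebraic dependence is detected by derivations (\<open>algebraic_on_vector_field\<close>). In characteristic
zero a derivation of an algebra of functions on \<open>Y\<close> extends, up to a nonzero factor, to the algebra
with one more function \<open>g\<close> adjoined, and its value at \<open>g\<close> can be made nonzero when \<open>g\<close> is transcendental
(\<open>extend_derivation\<close>). So if \<open>g\<close> is transcendental over the polynomials in \<open>h\<close>, then starting from the
zero derivation one reaches a derivation of all polynomial functions on \<open>Y\<close> that kills \<open>h\<close> but not \<open>g\<close>.
Such a derivation is a polynomial vector field that is tangent to \<open>Y\<close>, lies in the kernel of the differential of
\<open>h\<close>, and does not kill \<open>g\<close>.

If \<open>X\<close> is given by equations, a tangent vector field in the kernel of \<open>d\<mu>\<close> lies in \<open>ker d\<mu> \<inter> ker df\<close>. That intersection is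
zero at one point, hence at a generic point (\<open>generic_injective\<close>), hence the field vanishes and all
coordinates are algebraic.

If \<open>X\<close> is parametrized, the kernels of \<open>d\<phi>\<close> and \<open>d(\<mu> \<circ> \<phi>)\<close> agree at a generic point as soon as the rank of \<open>d\<phi>\<close> never
exceeds the rank \<open>d\<close> that \<open>d(\<mu> \<circ> \<phi>)\<close> attains (\<open>algebraic_on_generic_kernel\<close>). Here \<open>d\<close> is the length of
the longest chains of irreducible subvarieties, so what is needed is a chain of length \<open>e\<close> whenever \<open>d\<phi>\<close> has rank \<open>e\<close> at
some point \<open>t\<close> (\<open>rank_le_variety_dim\<close>). Its members are the closures of the images of affine subspaces
through \<open>t\<close> of dimensions \<open>0, \<dots>, e\<close> on whose directions \<open>d\<phi>\<close> is injective at \<open>t\<close>. They are distinct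
because the generic rank of a parametrization can be read off from the closure of its image: algebraic
relations between its coordinates bound the rank, and by the derivation criterion there are enough of them
(\<open>closure_neq_if_nullity\<close>).
\<close>

section \<open>Polynomial functions\<close>

lemma polynomial_fun_const: "polynomial_fun (\<lambda>x. c)"
  unfolding polynomial_fun_def
  by (rule exI[of _ "{\<lambda>_. 0}"], rule exI[of _ "\<lambda>_. c"]) simp

lemma polynomial_fun_coord:
  fixes l :: "'n::finite"
  shows "polynomial_fun (\<lambda>x :: 'k::real_normed_field ^ 'n. x $ l)"
proof -
  have "x $ l = (\<Prod>i\<in>UNIV. x $ i ^ (if i = l then 1 else 0))" for x :: "'k ^ 'n"
    by (subst prod.remove[of _ l]) auto
  then show ?thesis
    unfolding polynomial_fun_def
    by (intro exI[of _ "{\<lambda>i. if i = l then 1 else 0}"] exI[of _ "\<lambda>_. 1"]) auto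
qed

lemma polynomial_fun_add:
  assumes "polynomial_fun p" "polynomial_fun q"
  shows "polynomial_fun (\<lambda>x. p x + q x)"
proof -
  obtain A c where A: "finite A" and p: "p = (\<lambda>x. \<Sum>a\<in>A. c a * (\<Prod>i\<in>UNIV. x $ i ^ a i))"
    using assms(1) unfolding polynomial_fun_def by blast
  obtain B d where B: "finite B" and q: "q = (\<lambda>x. \<Sum>a\<in>B. d a * (\<Prod>i\<in>UNIV. x $ i ^ a i))"
    using assms(2) unfolding polynomial_fun_def by blast
  define e where "e a = (if a \<in> A then c a else 0) + (if a \<in> B then d a else 0)" for a
  have "p x + q x = (\<Sum>a\<in>A\<union>B. e a * (\<Prod>i\<in>UNIV. x $ i ^ a i))" for x
  proof -
    have "p x = (\<Sum>a\<in>A\<union>B. (if a \<in> A then c a else 0) * (\<Prod>i\<in>UNIV. x $ i ^ a i))"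
      unfolding p using A B by (intro sum.mono_neutral_cong_left) auto
    moreover have "q x = (\<Sum>a\<in>A\<union>B. (if a \<in> B then d a else 0) * (\<Prod>i\<in>UNIV. x $ i ^ a i))"
      unfolding q using A B by (intro sum.mono_neutral_cong_left) auto
    ultimately show ?thesis by (simp add: e_def distrib_right sum.distrib)
  qed
  then show ?thesis
    unfolding polynomial_fun_def using A B by (intro exI[of _ "A \<union> B"] exI[of _ e]) auto
qed

lemma polynomial_fun_sum:
  "(\<And>i. i \<in> I \<Longrightarrow> polynomial_fun (p i)) \<Longrightarrow> polynomial_fun (\<lambda>x. \<Sum>i\<in>I. p i x)"
  by (induction I rule: infinite_finite_induct) (auto intro: polynomial_fun_const polynomial_fun_add)

lemma polynomial_fun_mult:
  assumes "polynomial_fun p" "polynomial_fun q"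
  shows "polynomial_fun (\<lambda>x. p x * q x)"
proof -
  obtain A c where A: "finite A" and p: "p = (\<lambda>x. \<Sum>a\<in>A. c a * (\<Prod>i\<in>UNIV. x $ i ^ a i))"
    using assms(1) unfolding polynomial_fun_def by blast
  obtain B d where B: "finite B" and q: "q = (\<lambda>x. \<Sum>a\<in>B. d a * (\<Prod>i\<in>UNIV. x $ i ^ a i))"
    using assms(2) unfolding polynomial_fun_def by blast
  have "polynomial_fun (\<lambda>x. c a * (\<Prod>i\<in>UNIV. x $ i ^ a i) * (d b * (\<Prod>i\<in>UNIV. x $ i ^ b i)))" for a b
    unfolding polynomial_fun_def
    by (rule exI[of _ "{\<lambda>i. a i + b i}"], rule exI[of _ "\<lambda>_. c a * d b"])
       (simp add: power_add prod.distrib algebra_simps)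
  then show ?thesis
    unfolding p q sum_product by (intro polynomial_fun_sum)
qed

lemma polynomial_fun_prod:
  "(\<And>i. i \<in> I \<Longrightarrow> polynomial_fun (p i)) \<Longrightarrow> polynomial_fun (\<lambda>x. \<Prod>i\<in>I. p i x)"
  by (induction I rule: infinite_finite_induct) (auto intro: polynomial_fun_const polynomial_fun_mult)

lemmas polynomial_fun_intros = polynomial_fun_const polynomial_fun_coord polynomial_fun_add
  polynomial_fun_mult polynomial_fun_sum polynomial_fun_prod

text \<open>The set \<open>A\<close> is arbitrary here, so that the lemma serves both for the induction principle below and for
algebras of functions obtained by adjoining the coordinates.\<close>

lemma subalgebra_contains_polynomials:
  assumes p: "polynomial_fun p"
    and const: "\<And>c. (\<lambda>x. c) \<in> A"
    and coord: "\<And>l. (\<lambda>x. x $ l) \<in> A"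
    and add: "\<And>p q. p \<in> A \<Longrightarrow> q \<in> A \<Longrightarrow> p + q \<in> A"
    and mult: "\<And>p q. p \<in> A \<Longrightarrow> q \<in> A \<Longrightarrow> p * q \<in> A"
  shows "p \<in> A"
proof -
  obtain B c where B: "finite B" and p: "p = (\<lambda>x. \<Sum>a\<in>B. c a * (\<Prod>i\<in>UNIV. x $ i ^ a i))"
    using p unfolding polynomial_fun_def by blast
  have pow: "(\<lambda>x. x $ l ^ n) \<in> A" for l n
    by (induction n) (use const[of 1] mult[OF coord] in \<open>auto simp: times_fun_def\<close>)
  have prod: "(\<lambda>x. \<Prod>i\<in>I. x $ i ^ a i) \<in> A" for a and I :: "'b set"
    by (induction I rule: infinite_finite_induct) (use const[of 1] mult[OF pow] in \<open>auto simp: times_fun_def\<close>)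
  show ?thesis
    unfolding p using B
  proof (induction B)
    case empty
    then show ?case using const[of 0] by simp
  next
    case (insert b B)
    show ?case
      using add[OF mult[OF const prod] insert.IH] insert.hyps by (simp add: times_fun_def plus_fun_def)
  qed
qed

lemma polynomial_fun_induct [consumes 1, case_names const coord add mult]:
  assumes p: "polynomial_fun p"
    and const: "\<And>c. P (\<lambda>x. c)"
    and coord: "\<And>l. P (\<lambda>x. x $ l)"
    and add: "\<And>p q. polynomial_fun p \<Longrightarrow> polynomial_fun q \<Longrightarrow> P p \<Longrightarrow> P q \<Longrightarrow> P (\<lambda>x. p x + q x)"
    and mult: "\<And>p q. polynomial_fun p \<Longrightarrow> polynomial_fun q \<Longrightarrow> P p \<Longrightarrow> P q \<Longrightarrow> P (\<lambda>x. p x * q x)"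
  shows "P p"
proof -
  have "p \<in> {p. polynomial_fun p \<and> P p}"
    using p by (rule subalgebra_contains_polynomials)
      (auto intro: const coord add mult polynomial_fun_intros simp: plus_fun_def times_fun_def)
  then show ?thesis by simp
qed

lemma polynomial_fun_compose:
  assumes "polynomial_fun p" "polynomial_map g"
  shows "polynomial_fun (\<lambda>t. p (g t))"
  using assms(1)
  by (induction rule: polynomial_fun_induct) (use assms(2) in \<open>auto simp: polynomial_map_def intro: polynomial_fun_intros\<close>)

lemma polynomial_map_id: "polynomial_map (\<lambda>x. x)"
  by (simp add: polynomial_map_def polynomial_fun_coord)

lemma polynomial_map_compose:
  assumes "polynomial_map g" "polynomial_map h"
  shows "polynomial_map (\<lambda>t. g (h t))"
  unfolding polynomial_map_def
proof
  fix j
  show "polynomial_fun (\<lambda>t. g (h t) $ j)"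
    by (rule polynomial_fun_compose[of "\<lambda>x. g x $ j", OF _ assms(2)])
       (use assms(1) in \<open>simp add: polynomial_map_def\<close>)
qed

lemma polynomial_map_affine: "polynomial_map (\<lambda>t. c + A *v t)"
  unfolding polynomial_map_def matrix_vector_mult_def vector_add_component vec_lambda_beta
  by (intro allI polynomial_fun_intros)

section \<open>Directional derivatives of polynomial functions\<close>

text \<open>For a polynomial this real derivative is automatically linear over the ground field; see
\<open>dderiv_expand\<close>.\<close>

definition dderiv :: "('k::real_normed_field ^ 'n \<Rightarrow> 'k) \<Rightarrow> 'k ^ 'n \<Rightarrow> 'k ^ 'n \<Rightarrow> 'k" where
  "dderiv p x = frechet_derivative p (at x)"

lemma dderiv_eqI: "(p has_derivative p') (at x) \<Longrightarrow> dderiv p x v = p' v"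
  unfolding dderiv_def by (simp add: frechet_derivative_at[symmetric])

lemma has_derivative_dderiv:
  assumes "polynomial_fun p"
  shows "(p has_derivative dderiv p x) (at x)"
proof -
  have "p differentiable (at x)"
    using assms
  proof (induction rule: polynomial_fun_induct)
    case (coord l)
    show ?case by (rule bounded_linear_imp_differentiable) (rule bounded_linear_vec_nth)
  qed (auto intro: differentiable_add differentiable_mult)
  then show ?thesis
    unfolding dderiv_def by (simp add: frechet_derivative_works[symmetric])
qed

lemma dderiv_const [simp]: "dderiv (\<lambda>x. c) x v = 0"
  by (rule dderiv_eqI) (rule has_derivative_const)

lemma dderiv_coord [simp]: "dderiv (\<lambda>x. x $ l) x v = v $ l"
  by (rule dderiv_eqI) (rule bounded_linear_imp_has_derivative[OF bounded_linear_vec_nth])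

lemma dderiv_add:
  assumes "polynomial_fun p" "polynomial_fun q"
  shows "dderiv (\<lambda>x. p x + q x) x v = dderiv p x v + dderiv q x v"
  by (rule dderiv_eqI) (intro has_derivative_add has_derivative_dderiv assms)

lemma dderiv_mult:
  assumes "polynomial_fun p" "polynomial_fun q"
  shows "dderiv (\<lambda>x. p x * q x) x v = p x * dderiv q x v + dderiv p x v * q x"
  by (rule dderiv_eqI) (intro has_derivative_mult has_derivative_dderiv assms)

lemma dderiv_expand:
  assumes "polynomial_fun p"
  shows "dderiv p x v = (\<Sum>j\<in>UNIV. dderiv p x (axis j 1) * v $ j)"
  using assms
proof (induction rule: polynomial_fun_induct)
  case (coord l)
  have "axis j (1::'a) $ l * v $ j = (if j = l then v $ j else 0)" for j
    by (auto simp: axis_def)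
  then show ?case by (simp add: sum.delta)
qed (simp_all add: dderiv_add dderiv_mult sum.distrib sum_distrib_left sum_distrib_right algebra_simps)

lemma polynomial_fun_dderiv_const:
  assumes "polynomial_fun p"
  shows "polynomial_fun (\<lambda>x. dderiv p x v)"
  using assms
proof (induction rule: polynomial_fun_induct)
  case (mult p q)
  then show ?case by (simp add: dderiv_mult polynomial_fun_intros)
qed (auto simp: dderiv_add intro: polynomial_fun_intros)

lemma polynomial_fun_dderiv:
  assumes "polynomial_fun p" "polynomial_map v"
  shows "polynomial_fun (\<lambda>x. dderiv p x (v x))"
proof -
  have "polynomial_fun (\<lambda>x. \<Sum>j\<in>UNIV. dderiv p x (axis j 1) * v x $ j)"
    using assms by (intro polynomial_fun_sum polynomial_fun_mult polynomial_fun_dderiv_const)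
      (simp_all add: polynomial_map_def)
  also have "(\<lambda>x. \<Sum>j\<in>UNIV. dderiv p x (axis j 1) * v x $ j) = (\<lambda>x. dderiv p x (v x))"
    by (rule ext) (rule dderiv_expand[OF assms(1), symmetric])
  finally show ?thesis .
qed

lemma dderiv_compose:
  assumes p: "polynomial_fun p" and g: "polynomial_map g"
  shows "dderiv (\<lambda>t. p (g t)) t v = dderiv p (g t) (\<chi> i. dderiv (\<lambda>t. g t $ i) t v)"
  using p
proof (induction rule: polynomial_fun_induct)
  case (add p q)
  then show ?case by (simp add: dderiv_add polynomial_fun_compose[OF _ g])
next
  case (mult p q)
  then show ?case by (simp add: dderiv_mult polynomial_fun_compose[OF _ g])
qed simp_all

text \<open>Bridge between the Jacobian matrix, defined through the Frechet derivative of a vector-valued map, and the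
directional derivatives of the components, with which all later arguments work.\<close>

lemma jacobian_mult_nth:
  assumes g: "polynomial_map g"
  shows "(jacobian g (at x) *v v) $ i = dderiv (\<lambda>x. g x $ i) x v"
proof -
  have gi: "polynomial_fun (\<lambda>x. g x $ i)" for i
    using g by (simp add: polynomial_map_def)
  have "(g has_derivative (\<lambda>v. \<chi> i. dderiv (\<lambda>x. g x $ i) x v)) (at x)"
    unfolding has_derivative_def
  proof
    have bl: "bounded_linear (\<lambda>v. dderiv (\<lambda>x. g x $ i) x v)" for i
      using has_derivative_dderiv[OF gi] by (rule has_derivative_bounded_linear)
    have eq: "(\<lambda>v. \<chi> i. dderiv (\<lambda>x. g x $ i) x v) = (\<lambda>v. \<Sum>i\<in>UNIV. axis i (dderiv (\<lambda>x. g x $ i) x v))"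
      by (auto simp: fun_eq_iff vec_eq_iff axis_def sum.delta)
    have ax: "bounded_linear (axis i :: 'a \<Rightarrow> 'a ^ 'c)" for i
      proof (rule bounded_linear_intro)
      show "norm (axis i x :: 'a ^ 'c) \<le> norm x * 1" for x :: 'a
        using L2_set_le_sum[of UNIV "\<lambda>j. norm ((axis i x :: 'a ^ 'c) $ j)"]
        by (simp add: norm_vec_def axis_def if_distrib[where f = norm] sum.delta cong: if_cong)
    qed (auto simp: vec_eq_iff axis_def)
    show "bounded_linear (\<lambda>v. \<chi> i. dderiv (\<lambda>x. g x $ i) x v)"
      unfolding eq by (rule bounded_linear_sum) (rule bounded_linear_compose[OF ax bl])
    show "((\<lambda>y. (g y - g (Lim (at x) (\<lambda>x. x)) -
            (\<chi> i. dderiv (\<lambda>x. g x $ i) x (y - Lim (at x) (\<lambda>x. x)))) /\<^sub>R norm (y - Lim (at x) (\<lambda>x. x))) \<longlongrightarrow> 0) (at x)"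
    proof (rule vec_tendstoI)
      fix i
      show "((\<lambda>y. ((g y - g (Lim (at x) (\<lambda>x. x)) -
            (\<chi> i. dderiv (\<lambda>x. g x $ i) x (y - Lim (at x) (\<lambda>x. x)))) /\<^sub>R norm (y - Lim (at x) (\<lambda>x. x))) $ i) \<longlongrightarrow> 0 $ i) (at x)"
        using has_derivative_dderiv[OF gi, of i x]
        unfolding has_derivative_def vector_scaleR_component vector_minus_component vec_lambda_beta
          zero_index by (rule conjunct2)
    qed
  qed
  then have "frechet_derivative g (at x) = (\<lambda>v. \<chi> i. dderiv (\<lambda>x. g x $ i) x v)"
    by (rule frechet_derivative_at[symmetric])
  then have "jacobian g (at x) $ i $ j = dderiv (\<lambda>x. g x $ i) x (axis j 1)" for j
    by (simp add: jacobian_def matrix_def)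
  then show ?thesis
    by (subst dderiv_expand[OF gi]) (simp add: matrix_vector_mult_def)
qed

lemma jacobian_compose:
  assumes g: "polynomial_map g" and h: "polynomial_map h"
  shows "jacobian (\<lambda>t. g (h t)) (at t) *v v = jacobian g (at (h t)) *v (jacobian h (at t) *v v)"
proof (rule vec_eq_iff[THEN iffD2], rule allI)
  fix i
  have *: "(\<chi> i. dderiv (\<lambda>t. h t $ i) t v) = jacobian h (at t) *v v"
    by (simp add: vec_eq_iff jacobian_mult_nth h)
  have "polynomial_fun (\<lambda>x. g x $ i)"
    using g by (simp add: polynomial_map_def)
  from dderiv_compose[OF this h, of t v]
  show "(jacobian (\<lambda>t. g (h t)) (at t) *v v) $ i = (jacobian g (at (h t)) *v (jacobian h (at t) *v v)) $ i"
    unfolding * by (simp only: jacobian_mult_nth[OF g] jacobian_mult_nth[OF polynomial_map_compose[OF g h]])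
qed

lemma jacobian_affine:
  fixes A :: "'k::real_normed_field ^ 'n ^ 'm"
  shows "jacobian (\<lambda>t. c + A *v t) (at t) *v v = A *v v"
proof -
  have "dderiv (\<lambda>t. (c + A *v t) $ i) t v = (A *v v) $ i" for i
  proof -
    have s: "dderiv (\<lambda>t. \<Sum>j\<in>J. A $ i $ j * t $ j) t v = (\<Sum>j\<in>J. A $ i $ j * v $ j)" for J
      by (induction J rule: infinite_finite_induct)
         (auto simp: dderiv_add dderiv_mult polynomial_fun_intros)
    show ?thesis
      using dderiv_add[OF polynomial_fun_const polynomial_fun_sum, of UNIV "\<lambda>j t. A $ i $ j * t $ j" "c $ i" t v]
      by (simp add: matrix_vector_mult_def s polynomial_fun_intros)
  qed
  then show ?thesis
    by (simp add: vec_eq_iff jacobian_mult_nth[OF polynomial_map_affine])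
qed

section \<open>Extending derivations of algebras of functions\<close>

lemma sum_fun_apply [simp]: "(\<Sum>i\<in>I. F i) x = (\<Sum>i\<in>I. F i x)"
  by (induction I rule: infinite_finite_induct) auto

lemma power_fun_apply [simp]:
  fixes g :: "'a \<Rightarrow> 'k::monoid_mult"
  shows "(g ^ n) x = g x ^ n"
  by (induction n) auto

text \<open>Functions on the whole type are added and multiplied pointwise, and a set \<open>Y\<close> enters only through
\<open>zero_on Y\<close>: the coordinate ring of \<open>Y\<close> is represented by functions modulo those that vanish on \<open>Y\<close>.
Identities between functions are accordingly stated at the points of \<open>Y\<close>.\<close>

definition subalgebra :: "('a \<Rightarrow> 'k::field_char_0) set \<Rightarrow> bool" where
  "subalgebra A \<longleftrightarrow> (\<forall>c. (\<lambda>_. c) \<in> A) \<and> (\<forall>p\<in>A. \<forall>q\<in>A. p + q \<in> A \<and> p * q \<in> A)"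

definition zero_on :: "'a set \<Rightarrow> ('a \<Rightarrow> 'k::field_char_0) \<Rightarrow> bool" where
  "zero_on Y p \<longleftrightarrow> (\<forall>x\<in>Y. p x = 0)"

lemma subalgebra_closed:
  assumes "subalgebra A"
  shows "(\<lambda>_. c) \<in> A" "0 \<in> A" "1 \<in> A" "of_nat n \<in> A"
    and "p \<in> A \<Longrightarrow> q \<in> A \<Longrightarrow> p + q \<in> A"
    and "p \<in> A \<Longrightarrow> q \<in> A \<Longrightarrow> p * q \<in> A"
    and "p \<in> A \<Longrightarrow> q \<in> A \<Longrightarrow> p - q \<in> A"
    and "p \<in> A \<Longrightarrow> - p \<in> A"
    and "p \<in> A \<Longrightarrow> p ^ n \<in> A"
    and "(\<And>i. i \<in> I \<Longrightarrow> F i \<in> A) \<Longrightarrow> sum F I \<in> A"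
proof -
  show c: "(\<lambda>_. c) \<in> A" for c using assms by (simp add: subalgebra_def)
  show z: "0 \<in> A" using c[of 0] by (simp add: zero_fun_def)
  show o: "1 \<in> A" using c[of 1] by (simp add: one_fun_def)
  show "of_nat n \<in> A" using c[of "of_nat n"] by (simp add: of_nat_fun)
  show a: "p \<in> A \<Longrightarrow> q \<in> A \<Longrightarrow> p + q \<in> A" for p q using assms by (simp add: subalgebra_def)
  show m: "p \<in> A \<Longrightarrow> q \<in> A \<Longrightarrow> p * q \<in> A" for p q using assms by (simp add: subalgebra_def)
  show u: "p \<in> A \<Longrightarrow> - p \<in> A" for p
    using m[OF c[of "-1"], of p] by (simp add: times_fun_def fun_Compl_def)
  show "p \<in> A \<Longrightarrow> q \<in> A \<Longrightarrow> p - q \<in> A"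
    using a[OF _ u, of p q] by simp
  show "p \<in> A \<Longrightarrow> p ^ n \<in> A" by (induction n) (auto intro: o m)
  show "(\<And>i. i \<in> I \<Longrightarrow> F i \<in> A) \<Longrightarrow> sum F I \<in> A"
    by (induction I rule: infinite_finite_induct) (auto intro: z a)
qed

definition polys :: "('a \<Rightarrow> 'k::field_char_0) set \<Rightarrow> ('a \<Rightarrow> 'k) poly set" where
  "polys A = {P. \<forall>i. coeff P i \<in> A}"

lemma coeff_in: "P \<in> polys A \<Longrightarrow> coeff P i \<in> A"
  by (simp add: polys_def)

lemma polys_closed:
  assumes A: "subalgebra A"
  shows "0 \<in> polys A"
    and "P \<in> polys A \<Longrightarrow> Q \<in> polys A \<Longrightarrow> P + Q \<in> polys A"
    and "P \<in> polys A \<Longrightarrow> Q \<in> polys A \<Longrightarrow> P - Q \<in> polys A"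
    and "P \<in> polys A \<Longrightarrow> Q \<in> polys A \<Longrightarrow> P * Q \<in> polys A"
    and "a \<in> A \<Longrightarrow> P \<in> polys A \<Longrightarrow> smult a P \<in> polys A"
    and "a \<in> A \<Longrightarrow> P \<in> polys A \<Longrightarrow> pCons a P \<in> polys A"
    and "a \<in> A \<Longrightarrow> monom a n \<in> polys A"
  using subalgebra_closed[OF A]
  by (auto simp: polys_def coeff_mult coeff_pCons split: nat.split intro!: subalgebra_closed(10)[OF A])

lemma polys_pConsD:
  assumes "pCons a P \<in> polys A"
  shows "a \<in> A" "P \<in> polys A"
  using coeff_in[OF assms, of 0] coeff_in[OF assms, of "Suc _"] by (auto simp: polys_def)

lemma poly_fun_apply:
  fixes P :: "('a \<Rightarrow> 'k::field_char_0) poly"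
  assumes "degree P < n"
  shows "poly P g x = (\<Sum>i<n. coeff P i x * g x ^ i)"
proof -
  have "poly P g = (\<Sum>i<n. coeff P i * g ^ i)"
    unfolding poly_altdef using assms
    by (intro sum.mono_neutral_left) (auto simp: coeff_eq_0)
  then show ?thesis by simp
qed

lemma poly_in_subalgebra:
  assumes "subalgebra A" "P \<in> polys A" "g \<in> A"
  shows "poly P g \<in> A"
  unfolding poly_altdef
  by (intro subalgebra_closed[OF assms(1)] coeff_in assms)

text \<open>For \<open>P = \<Sum> p\<^sub>i T\<^sup>i\<close> the derivative of \<open>P(g)\<close> is \<open>\<Sum> d(p\<^sub>i) g\<^sup>i + P'(g) d(g)\<close>; the next two
functions are the sum over the coefficients and the factor \<open>P'(g)\<close>.\<close>

definition coeff_deriv ::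
    "(('a \<Rightarrow> 'k) \<Rightarrow> 'a \<Rightarrow> 'k) \<Rightarrow> ('a \<Rightarrow> 'k) \<Rightarrow> ('a \<Rightarrow> 'k::field_char_0) poly \<Rightarrow> 'a \<Rightarrow> 'k" where
  "coeff_deriv d g P = (\<Sum>i\<le>degree P. d (coeff P i) * g ^ i)"

definition formal_deriv :: "('a \<Rightarrow> 'k) \<Rightarrow> ('a \<Rightarrow> 'k::field_char_0) poly \<Rightarrow> 'a \<Rightarrow> 'k" where
  "formal_deriv g P = (\<Sum>i<degree P. of_nat (Suc i) * coeff P (Suc i) * g ^ i)"

text \<open>Vanishing on \<open>Y\<close> must be preserved for \<open>d\<close> to descend to functions on \<open>Y\<close>. The values may lie
in an algebra \<open>S\<close> larger than the domain \<open>A\<close>.\<close>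

definition derivation_on ::
    "'a set \<Rightarrow> ('a \<Rightarrow> 'k) set \<Rightarrow> ('a \<Rightarrow> 'k) set \<Rightarrow> (('a \<Rightarrow> 'k::field_char_0) \<Rightarrow> 'a \<Rightarrow> 'k) \<Rightarrow> bool" where
  "derivation_on Y S A d \<longleftrightarrow>
     (\<forall>p\<in>A. d p \<in> S \<and> (zero_on Y p \<longrightarrow> zero_on Y (d p))) \<and>
     (\<forall>c. zero_on Y (d (\<lambda>_. c))) \<and>
     (\<forall>p\<in>A. \<forall>q\<in>A. \<forall>x\<in>Y. d (p + q) x = d p x + d q x \<and> d (p * q) x = p x * d q x + d p x * q x)"

lemma derivation_onD:
  assumes "derivation_on Y S A d"
  shows "p \<in> A \<Longrightarrow> d p \<in> S"
    and "p \<in> A \<Longrightarrow> zero_on Y p \<Longrightarrow> zero_on Y (d p)"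
    and "x \<in> Y \<Longrightarrow> d (\<lambda>_. c) x = 0"
    and "x \<in> Y \<Longrightarrow> d 0 x = 0"
    and "p \<in> A \<Longrightarrow> q \<in> A \<Longrightarrow> x \<in> Y \<Longrightarrow> d (p + q) x = d p x + d q x"
    and "p \<in> A \<Longrightarrow> q \<in> A \<Longrightarrow> x \<in> Y \<Longrightarrow> d (p * q) x = p x * d q x + d p x * q x"
proof -
  show *: "x \<in> Y \<Longrightarrow> d (\<lambda>_. c) x = 0" for c using assms by (auto simp: derivation_on_def zero_on_def)
  show "x \<in> Y \<Longrightarrow> d 0 x = 0" using *[of 0] by (simp add: zero_fun_def)
qed (use assms in \<open>auto simp: derivation_on_def\<close>)

lemma coeff_deriv_bound:
  assumes d: "derivation_on Y S A d" and "x \<in> Y" "degree P < n"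
  shows "coeff_deriv d g P x = (\<Sum>i<n. d (coeff P i) x * g x ^ i)"
proof -
  have "(\<Sum>i\<le>degree P. d (coeff P i) x * g x ^ i) = (\<Sum>i<n. d (coeff P i) x * g x ^ i)"
    using assms by (intro sum.mono_neutral_left) (auto simp: coeff_eq_0 derivation_onD(4)[OF d])
  then show ?thesis by (simp add: coeff_deriv_def)
qed

lemma formal_deriv_bound:
  assumes "degree P \<le> n"
  shows "formal_deriv g P x = (\<Sum>i<n. of_nat (Suc i) * coeff P (Suc i) x * g x ^ i)"
proof -
  have "(\<Sum>i<degree P. of_nat (Suc i) * coeff P (Suc i) x * g x ^ i)
      = (\<Sum>i<n. of_nat (Suc i) * coeff P (Suc i) x * g x ^ i)"
    using assms by (intro sum.mono_neutral_left) (auto simp: coeff_eq_0)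
  then show ?thesis by (simp add: formal_deriv_def)
qed

text \<open>The value at \<open>P(g)\<close> of the derivation that is \<open>s d\<close> on coefficients and takes the value \<open>w\<close> at \<open>g\<close>. The
factor \<open>s\<close> makes fractions unnecessary: extending \<open>d\<close> itself would require \<open>d(g) = - Q\<^sup>d(g) / Q'(g)\<close>,
with \<open>Q\<close> a minimal polynomial of \<open>g\<close>.\<close>

definition lift_deriv ::
    "(('a \<Rightarrow> 'k) \<Rightarrow> 'a \<Rightarrow> 'k) \<Rightarrow> ('a \<Rightarrow> 'k) \<Rightarrow> ('a \<Rightarrow> 'k) \<Rightarrow> ('a \<Rightarrow> 'k) \<Rightarrow> ('a \<Rightarrow> 'k::field_char_0) poly \<Rightarrow> 'a \<Rightarrow> 'k"
  where "lift_deriv d s w g P = s * coeff_deriv d g P + w * formal_deriv g P"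

context
  fixes Y :: "'a set" and S A :: "('a \<Rightarrow> 'k::field_char_0) set" and d and s w g :: "'a \<Rightarrow> 'k"
  assumes A: "subalgebra A" and d: "derivation_on Y S A d"
begin

lemma lift_deriv_0: "x \<in> Y \<Longrightarrow> lift_deriv d s w g 0 x = 0"
  by (simp add: lift_deriv_def coeff_deriv_def formal_deriv_def derivation_onD(4)[OF d])

lemma lift_deriv_add:
  assumes x: "x \<in> Y" and P: "P \<in> polys A" and Q: "Q \<in> polys A"
  shows "lift_deriv d s w g (P + Q) x = lift_deriv d s w g P x + lift_deriv d s w g Q x"
proof -
  define n where "n = Suc (max (degree P) (degree Q))"
  have deg: "degree P < n" "degree Q < n" "degree (P + Q) < n"
    unfolding n_def using degree_add_le_max[of P Q] by linarith+
  have "coeff_deriv d g (P + Q) x = coeff_deriv d g P x + coeff_deriv d g Q x"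
    unfolding coeff_deriv_bound[OF d x deg(1)] coeff_deriv_bound[OF d x deg(2)]
      coeff_deriv_bound[OF d x deg(3)]
    by (simp add: derivation_onD(5)[OF d coeff_in[OF P] coeff_in[OF Q] x] sum.distrib distrib_right)
  moreover have "formal_deriv g (P + Q) x = formal_deriv g P x + formal_deriv g Q x"
    using deg by (simp add: formal_deriv_bound[of _ n] sum.distrib algebra_simps)
  ultimately show ?thesis by (simp add: lift_deriv_def algebra_simps)
qed

lemma lift_deriv_smult:
  assumes x: "x \<in> Y" and a: "a \<in> A" and P: "P \<in> polys A"
  shows "lift_deriv d s w g (smult a P) x = a x * lift_deriv d s w g P x + s x * d a x * poly P g x"
proof -
  define n where "n = Suc (degree P)"
  have deg: "degree P < n" "degree (smult a P) < n"
    unfolding n_def using degree_smult_le[of a P] by linarith+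
  have "coeff_deriv d g (smult a P) x = a x * coeff_deriv d g P x + d a x * poly P g x"
    unfolding coeff_deriv_bound[OF d x deg(1)] coeff_deriv_bound[OF d x deg(2)] poly_fun_apply[OF deg(1)]
    by (simp add: derivation_onD(6)[OF d a coeff_in[OF P] x] sum.distrib distrib_right
        sum_distrib_left mult.assoc)
  moreover have "formal_deriv g (smult a P) x = a x * formal_deriv g P x"
    using deg by (simp add: formal_deriv_bound[of _ n] sum_distrib_left algebra_simps)
  ultimately show ?thesis by (simp add: lift_deriv_def algebra_simps)
qed

lemma lift_deriv_pCons:
  assumes x: "x \<in> Y" and P: "pCons a P \<in> polys A"
  shows "lift_deriv d s w g (pCons a P) x = s x * d a x + g x * lift_deriv d s w g P x + w x * poly P g x"
proof -
  define n where "n = Suc (degree P)"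
  have deg: "degree P < n" "degree (pCons a P) < Suc n"
    unfolding n_def using degree_pCons_le[of a P] by linarith+
  have "coeff_deriv d g (pCons a P) x = d a x + g x * coeff_deriv d g P x"
    unfolding coeff_deriv_bound[OF d x deg(1)] coeff_deriv_bound[OF d x deg(2)] sum.lessThan_Suc_shift
    by (simp add: sum_distrib_left algebra_simps)
  moreover have "formal_deriv g (pCons a P) x = poly P g x + g x * formal_deriv g P x"
  proof -
    have "(\<Sum>i<n. of_nat (Suc i) * coeff P i x * g x ^ i)
        = (\<Sum>i<n. coeff P i x * g x ^ i) + (\<Sum>i<n. of_nat i * coeff P i x * g x ^ i)"
      by (simp add: algebra_simps sum.distrib)
    also have "(\<Sum>i<n. of_nat i * coeff P i x * g x ^ i) = g x * formal_deriv g P x"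
      unfolding n_def sum.lessThan_Suc_shift
      by (simp add: formal_deriv_bound[of P "degree P"] sum_distrib_left algebra_simps)
    finally show ?thesis
      using deg by (simp add: formal_deriv_bound[of _ n] poly_fun_apply[of P n] del: of_nat_Suc)
  qed
  ultimately show ?thesis by (simp add: lift_deriv_def algebra_simps)
qed

lemma lift_deriv_mult:
  assumes x: "x \<in> Y" and P: "P \<in> polys A" and Q: "Q \<in> polys A"
  shows "lift_deriv d s w g (P * Q) x = poly P g x * lift_deriv d s w g Q x + lift_deriv d s w g P x * poly Q g x"
  using P
proof (induction P)
  case 0
  then show ?case by (simp add: lift_deriv_0[OF x])
next
  case (pCons a P)
  note aP = polys_pConsD[OF pCons.prems]
  have PQ: "P * Q \<in> polys A" "pCons 0 (P * Q) \<in> polys A" "smult a Q \<in> polys A"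
    by (intro polys_closed[OF A] subalgebra_closed(2)[OF A] aP Q)+
  show ?case
    unfolding mult_pCons_left lift_deriv_add[OF x PQ(3,2)] lift_deriv_smult[OF x aP(1) Q]
      lift_deriv_pCons[OF x PQ(2)] lift_deriv_pCons[OF x pCons.prems] pCons.IH[OF aP(2)]
    by (simp add: derivation_onD(4)[OF d x] algebra_simps)
qed

lemma lift_deriv_diff:
  assumes x: "x \<in> Y" and P: "P \<in> polys A" and Q: "Q \<in> polys A"
  shows "lift_deriv d s w g (P - Q) x = lift_deriv d s w g P x - lift_deriv d s w g Q x"
  using lift_deriv_add[OF x polys_closed(3)[OF A P Q] Q] by simp

lemma lift_deriv_in:
  assumes "subalgebra S" "A \<subseteq> S" "s \<in> S" "w \<in> S" "g \<in> S" "P \<in> polys A"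
  shows "lift_deriv d s w g P \<in> S"
  unfolding lift_deriv_def coeff_deriv_def formal_deriv_def
  using assms coeff_in[OF assms(6)] derivation_onD(1)[OF d]
  by (intro subalgebra_closed[OF assms(1)]) auto

end

definition adjoin :: "('a \<Rightarrow> 'k::field_char_0) set \<Rightarrow> ('a \<Rightarrow> 'k) \<Rightarrow> ('a \<Rightarrow> 'k) set" where
  "adjoin A g = (\<lambda>P. poly P g) ` polys A"

lemma subalgebra_adjoin:
  assumes A: "subalgebra A"
  shows "subalgebra (adjoin A g)" "A \<subseteq> adjoin A g" "g \<in> adjoin A g"
proof -
  have const: "a \<in> adjoin A g" if "a \<in> A" for a
    unfolding adjoin_def using that polys_closed(1,6)[OF A] by (intro image_eqI[of _ _ "[:a:]"]) auto
  then show "A \<subseteq> adjoin A g" by blast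
  show "subalgebra (adjoin A g)"
    unfolding subalgebra_def
  proof (intro conjI allI ballI)
    show "(\<lambda>_. c) \<in> adjoin A g" for c by (intro const subalgebra_closed(1)[OF A])
    fix p q assume "p \<in> adjoin A g" "q \<in> adjoin A g"
    then obtain P Q where PQ: "P \<in> polys A" "Q \<in> polys A" and eq: "p = poly P g" "q = poly Q g"
      unfolding adjoin_def by blast
    show "p + q \<in> adjoin A g" "p * q \<in> adjoin A g"
      unfolding eq adjoin_def poly_add[symmetric] poly_mult[symmetric]
      using polys_closed(2,4)[OF A PQ] by blast+
  qed
  show "g \<in> adjoin A g"
    unfolding adjoin_def using polys_closed(7)[OF A subalgebra_closed(3)[OF A], of 1]
    by (intro image_eqI[of _ _ "monom 1 1"]) (auto simp: poly_monom)
qed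

lemma adjoin_subset:
  assumes "subalgebra S" "A \<subseteq> S" "g \<in> S"
  shows "adjoin A g \<subseteq> S"
  unfolding adjoin_def using assms(2) poly_in_subalgebra[OF assms(1) _ assms(3)] by (auto simp: polys_def)

text \<open>An element of \<open>A[g]\<close> has many representations \<open>P(g)\<close>. The hypothesis \<open>van\<close> says exactly that the value
of the lift, modulo functions vanishing on \<open>Y\<close>, does not depend on the choice.\<close>

lemma derivation_adjoin:
  assumes A: "subalgebra A" and d: "derivation_on Y S A d"
    and S: "subalgebra S" "A \<subseteq> S" "s \<in> S" "w \<in> S" "g \<in> S"
    and van: "\<And>P. P \<in> polys A \<Longrightarrow> zero_on Y (poly P g) \<Longrightarrow> zero_on Y (lift_deriv d s w g P)"
  obtains d' where "derivation_on Y S (adjoin A g) d'"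
    and "\<And>a x. a \<in> A \<Longrightarrow> x \<in> Y \<Longrightarrow> d' a x = s x * d a x" "\<And>x. x \<in> Y \<Longrightarrow> d' g x = w x"
proof -
  define R where "R f = (SOME P. P \<in> polys A \<and> poly P g = f)" for f
  define d' where "d' f = lift_deriv d s w g (R f)" for f
  have R: "R (poly P g) \<in> polys A \<and> poly (R (poly P g)) g = poly P g" if "P \<in> polys A" for P
    unfolding R_def by (rule someI[of _ P]) (simp add: that)
  have d': "d' (poly P g) x = lift_deriv d s w g P x" if P: "P \<in> polys A" and x: "x \<in> Y" for P x
  proof -
    have "zero_on Y (lift_deriv d s w g (R (poly P g) - P))"
      using R[OF P] P by (intro van polys_closed[OF A]) (auto simp: zero_on_def)
    with x show ?thesis
      using lift_deriv_diff[OF A d x conjunct1[OF R[OF P]] P, of s w g] by (simp add: d'_def zero_on_def)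
  qed
  have const: "[:a:] \<in> polys A" if "a \<in> A" for a
    using that polys_closed(1,6)[OF A] by blast
  have da: "d' a x = s x * d a x" if "a \<in> A" "x \<in> Y" for a x
    using d'[OF const[OF that(1)] that(2)] lift_deriv_pCons[OF A d that(2) const[OF that(1)], of s w g]
    by (simp add: lift_deriv_0[OF A d that(2)])
  have "derivation_on Y S (adjoin A g) d'"
    unfolding derivation_on_def
  proof (intro conjI ballI impI allI)
    fix p assume "p \<in> adjoin A g"
    then obtain P where P: "P \<in> polys A" and p: "p = poly P g"
      unfolding adjoin_def by blast
    show "d' p \<in> S"
      unfolding d'_def p using R[OF P] by (intro lift_deriv_in[OF A d S]) auto
    show "zero_on Y (d' p)" if "zero_on Y p"
      using van[OF P that[unfolded p]] d'[OF P] unfolding p zero_on_def by simp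
    fix q x assume "q \<in> adjoin A g" and x: "x \<in> Y"
    then obtain Q where Q: "Q \<in> polys A" and q: "q = poly Q g"
      unfolding adjoin_def by blast
    show "d' (p + q) x = d' p x + d' q x"
      unfolding p q poly_add[symmetric] d'[OF P x] d'[OF Q x] d'[OF polys_closed(2)[OF A P Q] x]
      by (rule lift_deriv_add[OF A d x P Q])
    show "d' (p * q) x = p x * d' q x + d' p x * q x"
      unfolding p q poly_mult[symmetric] d'[OF P x] d'[OF Q x] d'[OF polys_closed(4)[OF A P Q] x]
      by (rule lift_deriv_mult[OF A d x P Q])
  next
    show "zero_on Y (d' (\<lambda>_. c))" for c
      unfolding zero_on_def using da[OF subalgebra_closed(1)[OF A]] derivation_onD(3)[OF d] by simp
  qed
  moreover have "d' g x = w x" if x: "x \<in> Y" for x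
  proof -
    have P: "pCons 0 [:1:] \<in> polys A" "[:1:] \<in> polys A"
      using polys_closed(1,6)[OF A] subalgebra_closed(2,3)[OF A] by blast+
    have d1: "d 1 x = 0"
      using derivation_onD(3)[OF d x, of 1] by (simp add: one_fun_def)
    show ?thesis
      using d'[OF P(1) x] lift_deriv_pCons[OF A d x P(1), of s w g] lift_deriv_pCons[OF A d x P(2), of s w g]
      by (simp add: lift_deriv_0[OF A d x] derivation_onD(4)[OF d x] d1)
  qed
  ultimately show ?thesis using da that by blast
qed

text \<open>Some coefficient, not necessarily the leading one, is required to be nonzero on \<open>Y\<close>. With this
choice transcendence means directly that every relation has all its coefficients zero on \<open>Y\<close>.\<close>

definition algebraic_on :: "'a set \<Rightarrow> ('a \<Rightarrow> 'k::field_char_0) set \<Rightarrow> ('a \<Rightarrow> 'k) \<Rightarrow> bool" where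
  "algebraic_on Y A g \<longleftrightarrow> (\<exists>P\<in>polys A. zero_on Y (poly P g) \<and> (\<exists>i. \<not> zero_on Y (coeff P i)))"

text \<open>A relation of least degree. Separability is automatic in characteristic zero: \<open>Q'\<close> has smaller degree, so
\<open>Q'(g) = 0\<close> would force all coefficients of \<open>Q'\<close>, and with them the leading coefficient of \<open>Q\<close>, to vanish
on \<open>Y\<close>.\<close>

lemma algebraic_on_minimal:
  assumes A: "subalgebra A" and alg: "algebraic_on Y A g"
  obtains Q where "Q \<in> polys A" "zero_on Y (poly Q g)" "\<not> zero_on Y (coeff Q (degree Q))"
    "\<not> zero_on Y (formal_deriv g Q)"
    "\<And>P i. P \<in> polys A \<Longrightarrow> zero_on Y (poly P g) \<Longrightarrow> (\<And>i. i \<ge> degree Q \<Longrightarrow> coeff P i = 0) \<Longrightarrow> zero_on Y (coeff P i)"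
proof -
  define R where "R n P \<longleftrightarrow> P \<in> polys A \<and> zero_on Y (poly P g) \<and> (\<exists>i. \<not> zero_on Y (coeff P i)) \<and> (\<forall>i>n. coeff P i = 0)" for n P
  obtain P where "R (degree P) P"
    using alg coeff_eq_0 unfolding algebraic_on_def R_def by blast
  then obtain n where n: "\<exists>P. R n P" and least: "\<And>m. \<exists>P. R m P \<Longrightarrow> n \<le> m"
    using LeastI_ex[of "\<lambda>n. \<exists>P. R n P"] Least_le[of "\<lambda>n. \<exists>P. R n P"] by blast
  obtain Q where Q: "R n Q" using n by blast
  have min: "zero_on Y (coeff P i)" if "P \<in> polys A" "zero_on Y (poly P g)" "\<And>i. i \<ge> n \<Longrightarrow> coeff P i = 0" for P i
  proof (rule ccontr)
    assume i: "\<not> zero_on Y (coeff P i)"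
    then have "i < n" using that(3)[of i] by (cases "i < n") (auto simp: zero_on_def)
    then have "R (n - 1) P" using that i unfolding R_def by auto
    then have "n \<le> n - 1" by (intro least exI)
    with \<open>i < n\<close> show False by auto
  qed
  have top: "\<not> zero_on Y (coeff Q n)"
  proof
    assume z: "zero_on Y (coeff Q n)"
    have mem: "Q - monom (coeff Q n) n \<in> polys A"
      using Q by (intro polys_closed[OF A] coeff_in) (auto simp: R_def)
    have "zero_on Y (poly (Q - monom (coeff Q n) n) g)"
      using Q z unfolding zero_on_def R_def by (simp add: poly_monom)
    then have "zero_on Y (coeff (Q - monom (coeff Q n) n) i)" for i
      using Q by (intro min mem) (auto simp: R_def)
    then have "zero_on Y (coeff Q i)" for i
      using z by (cases "i = n") (simp_all, metis diff_zero)
    with Q show False by (auto simp: R_def)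
  qed
  then have "coeff Q n \<noteq> 0" by (auto simp: zero_on_def)
  then have deg: "degree Q = n"
    using Q by (intro antisym degree_le le_degree) (auto simp: R_def)
  have "\<not> zero_on Y (formal_deriv g Q)"
  proof
    assume z: "zero_on Y (formal_deriv g Q)"
    \<comment> \<open>The formal derivative of \<open>Q\<close> as a polynomial with coefficients in \<open>A\<close>.\<close>
    define P where "P = (\<Sum>i<n. monom (of_nat (Suc i) * coeff Q (Suc i)) i)"
    have coeff_P: "coeff P i = (if i < n then of_nat (Suc i) * coeff Q (Suc i) else 0)" for i
      unfolding P_def coeff_sum coeff_monom by (simp add: sum.delta' del: of_nat_Suc)
    have QA: "coeff Q i \<in> A" for i using Q by (simp add: R_def polys_def)
    have "P \<in> polys A"
      unfolding polys_def using QA subalgebra_closed[OF A] by (auto simp: coeff_P simp del: of_nat_Suc)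
    moreover have "zero_on Y (poly P g)"
      using z unfolding P_def formal_deriv_def deg poly_sum by (simp add: poly_monom zero_on_def del: of_nat_Suc)
    ultimately have P0: "zero_on Y (coeff P i)" for i
      by (rule min) (simp add: coeff_P)
    have Q0: "zero_on Y (coeff Q (Suc i))" if "i < n" for i
      using P0[of i] that by (auto simp: coeff_P zero_on_def simp del: of_nat_Suc)
    show False
    proof (cases n)
      case 0
      then have "poly Q g = coeff Q 0" using deg by (auto elim: degree_eq_zeroE)
      with Q top 0 show False by (simp add: R_def)
    next
      case (Suc m)
      with Q0[of m] top show False by simp
    qed
  qed
  with Q top deg min show ?thesis by (intro that[of Q]) (auto simp: R_def)
qed

locale function_domain =
  fixes Y :: "'a set" and S :: "('a \<Rightarrow> 'k::field_char_0) set"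
  assumes sub: "subalgebra S" and nonempty: "Y \<noteq> {}"
    and no_zero_divisors: "p \<in> S \<Longrightarrow> q \<in> S \<Longrightarrow> zero_on Y (p * q) \<Longrightarrow> zero_on Y p \<or> zero_on Y q"
begin

text \<open>If \<open>g\<close> is transcendental there are no relations to respect, and \<open>d(g) = 1\<close> is a possible value. If \<open>g\<close> is
algebraic with minimal relation \<open>Q\<close>, the choice \<open>s = Q'(g)\<close>, \<open>w = - Q\<^sup>d(g)\<close> makes the lift vanish at
\<open>Q\<close>; that it vanishes at every other relation \<open>P\<close> is seen by reducing \<open>P\<close> modulo \<open>Q\<close>, one leading
coefficient at a time.\<close>

lemma extend_derivation:
  assumes A: "subalgebra A" "A \<subseteq> S" and d: "derivation_on Y S A d" and g: "g \<in> S"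
  obtains s d' where "s \<in> S" "\<not> zero_on Y s" "derivation_on Y S (adjoin A g) d'"
    "\<And>a x. a \<in> A \<Longrightarrow> x \<in> Y \<Longrightarrow> d' a x = s x * d a x"
    "\<not> algebraic_on Y A g \<Longrightarrow> \<not> zero_on Y (d' g)"
proof (cases "algebraic_on Y A g")
  case False
  have one: "1 \<in> S" "\<not> zero_on Y 1"
    using subalgebra_closed(3)[OF sub] nonempty by (auto simp: zero_on_def)
  have "zero_on Y (lift_deriv d 1 1 g P)" if P: "P \<in> polys A" "zero_on Y (poly P g)" for P
  proof -
    have c: "zero_on Y (coeff P i)" for i
      using False P unfolding algebraic_on_def by blast
    moreover have "zero_on Y (d (coeff P i))" for i
      by (rule derivation_onD(2)[OF d coeff_in[OF P(1)] c])
    ultimately show ?thesis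
      by (simp add: zero_on_def lift_deriv_def coeff_deriv_def formal_deriv_def)
  qed
  then show ?thesis
  proof (rule derivation_adjoin[OF A(1) d sub A(2) one(1) one(1) g])
    fix d' assume d': "derivation_on Y S (adjoin A g) d'"
      "\<And>a x. a \<in> A \<Longrightarrow> x \<in> Y \<Longrightarrow> d' a x = 1 x * d a x" "\<And>x. x \<in> Y \<Longrightarrow> d' g x = 1 x"
    show ?thesis
      by (rule that[OF one d'(1,2)]) (use d'(3) nonempty in \<open>auto simp: zero_on_def\<close>)
  qed
next
  case True
  obtain Q where Q: "Q \<in> polys A" "zero_on Y (poly Q g)" "\<not> zero_on Y (coeff Q (degree Q))"
    "\<not> zero_on Y (formal_deriv g Q)"
    and min: "\<And>P i. P \<in> polys A \<Longrightarrow> zero_on Y (poly P g) \<Longrightarrow> (\<And>i. i \<ge> degree Q \<Longrightarrow> coeff P i = 0) \<Longrightarrow> zero_on Y (coeff P i)"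
    using algebraic_on_minimal[OF A(1) True] by metis
  define s where "s = formal_deriv g Q"
  define w where "w = - coeff_deriv d g Q"
  define l where "l = coeff Q (degree Q)"
  have QS: "coeff Q i \<in> A" "coeff Q i \<in> S" "d (coeff Q i) \<in> S" for i
    using coeff_in[OF Q(1)] A(2) derivation_onD(1)[OF d] by auto
  have sw: "s \<in> S" "w \<in> S"
    unfolding s_def w_def formal_deriv_def coeff_deriv_def
    by (intro subalgebra_closed[OF sub] g QS)+
  let ?E = "lift_deriv d s w g"
  have EQ: "?E Q x = 0" for x
    by (simp add: lift_deriv_def s_def w_def)
  have "zero_on Y (?E P)" if P: "P \<in> polys A" "zero_on Y (poly P g)" for P
  proof -
    have "\<forall>P. P \<in> polys A \<and> zero_on Y (poly P g) \<and> (\<forall>i\<ge>m. coeff P i = 0) \<longrightarrow> zero_on Y (?E P)" for m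
    proof (induction m)
      case 0
      have "zero_on Y (?E P)" if "\<forall>i\<ge>0. coeff P i = 0" for P
      proof -
        have "P = 0" using that by (intro poly_eqI) simp
        then show ?thesis by (simp add: zero_on_def lift_deriv_0[OF A(1) d])
      qed
      then show ?case by blast
    next
      case (Suc m)
      show ?case
      proof (intro allI impI)
        fix P assume P: "P \<in> polys A \<and> zero_on Y (poly P g) \<and> (\<forall>i\<ge>Suc m. coeff P i = 0)"
        define c where "c = coeff P m"
        have PA: "P \<in> polys A" and cA: "c \<in> A" using P by (auto simp: c_def polys_def)
        have mon: "monom 1 k \<in> polys A" for k
          by (intro polys_closed[OF A(1)] subalgebra_closed[OF A(1)])
        show "zero_on Y (?E P)"
        proof (cases "zero_on Y c")
          case True
          let ?M = "smult c (monom 1 m)"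
          have M: "?M \<in> polys A" by (intro polys_closed[OF A(1)] cA mon)
          have "zero_on Y (?E (P - ?M))"
          proof (rule Suc.IH[rule_format], intro conjI allI impI)
            show "P - ?M \<in> polys A" by (intro polys_closed[OF A(1)] PA M)
            show "zero_on Y (poly (P - ?M) g)" using P True by (simp add: zero_on_def)
            show "coeff (P - ?M) i = 0" if "m \<le> i" for i
              using P that by (cases "i = m") (auto simp: c_def coeff_monom)
          qed
          moreover have "zero_on Y (?E ?M)"
            using derivation_onD(2)[OF d cA True] True
            by (simp add: zero_on_def lift_deriv_smult[OF A(1) d _ cA mon])
          ultimately show ?thesis
            by (simp add: zero_on_def lift_deriv_diff[OF A(1) d _ PA M])
        next
          case False
          have "degree Q \<le> m"
          proof (rule ccontr)
            assume "\<not> degree Q \<le> m"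
            then have "zero_on Y c" unfolding c_def using P by (intro min) auto
            with False show False ..
          qed
          let ?M = "monom 1 (m - degree Q)"
          \<comment> \<open>\<open>l P - T\<close> is the first step of the pseudo-division of \<open>P\<close> by \<open>Q\<close>.\<close>
          let ?T = "smult c (?M * Q)"
          have mem: "?M * Q \<in> polys A" "?T \<in> polys A" "smult l P \<in> polys A"
            unfolding l_def by (intro polys_closed[OF A(1)] cA mon Q(1) QS PA)+
          have "zero_on Y (?E (smult l P - ?T))"
          proof (rule Suc.IH[rule_format], intro conjI allI impI)
            show "smult l P - ?T \<in> polys A" by (intro polys_closed(3)[OF A(1)] mem)
            show "zero_on Y (poly (smult l P - ?T) g)" using P Q(2) by (simp add: zero_on_def)
            show "coeff (smult l P - ?T) i = 0" if i: "m \<le> i" for i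
            proof (cases "i = m")
              case True
              then show ?thesis
                using \<open>degree Q \<le> m\<close> by (simp add: coeff_monom_mult l_def c_def mult.commute[of "lead_coeff Q"])
            next
              case False
              with i have "coeff P i = 0" "degree Q < i - (m - degree Q)"
                using P \<open>degree Q \<le> m\<close> by auto
              then show ?thesis by (simp add: coeff_monom_mult coeff_eq_0)
            qed
          qed
          moreover have "?E (smult l P - ?T) x = (l * ?E P) x" if x: "x \<in> Y" for x
          proof -
            have lA: "l \<in> A" by (simp add: l_def QS)
            have 0: "poly P g x = 0" "poly Q g x = 0"
              using P Q(2) x by (auto simp: zero_on_def)
            then have "?E (?M * Q) x = 0"
              using lift_deriv_mult[OF A(1) d x mon Q(1), of s w g] EQ[of x] by simp
            with 0 show ?thesis
              unfolding lift_deriv_diff[OF A(1) d x mem(3,2)] lift_deriv_smult[OF A(1) d x cA mem(1)]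
                lift_deriv_smult[OF A(1) d x lA PA]
              by simp
          qed
          ultimately have "zero_on Y (l * ?E P)" by (simp add: zero_on_def)
          then show ?thesis
            using no_zero_divisors[of l "?E P"] Q(3) QS lift_deriv_in[OF A(1) d sub A(2) sw g PA]
            by (auto simp: l_def)
        qed
      qed
    qed
    from this[of "Suc (degree P)"] P show ?thesis by (simp add: coeff_eq_0)
  qed
  then show ?thesis
  proof (rule derivation_adjoin[OF A(1) d sub A(2) sw g])
    fix d' assume d': "derivation_on Y S (adjoin A g) d'"
      "\<And>a x. a \<in> A \<Longrightarrow> x \<in> Y \<Longrightarrow> d' a x = s x * d a x"
    show ?thesis
      by (rule that[OF sw(1) _ d'(1,2)]) (use Q(4) True in \<open>auto simp: s_def\<close>)
  qed
qed

text \<open>The derivation is zero on \<open>A\<close> and nonzero at \<open>g\<close> after the first adjunction; each of the functions \<open>c l\<close>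
adjoined afterwards only multiplies these values by a nonzero factor.\<close>

lemma derivation_adjoin_finite:
  assumes A: "subalgebra A" "A \<subseteq> S" and g: "g \<in> S" "\<not> algebraic_on Y A g"
    and "finite T" "\<And>l. l \<in> T \<Longrightarrow> c l \<in> S"
  shows "\<exists>B d. subalgebra B \<and> B \<subseteq> S \<and> A \<subseteq> B \<and> g \<in> B \<and> c ` T \<subseteq> B \<and> derivation_on Y S B d \<and>
           (\<forall>a\<in>A. zero_on Y (d a)) \<and> \<not> zero_on Y (d g)"
  using assms(5,6)
proof (induction T)
  case empty
  have "derivation_on Y S A (\<lambda>_. 0)"
    using subalgebra_closed(2)[OF sub] by (auto simp: derivation_on_def zero_on_def)
  from A this g(1) show ?case
  proof (rule extend_derivation)
    fix s d' assume d': "derivation_on Y S (adjoin A g) d'"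
      "\<And>a x. a \<in> A \<Longrightarrow> x \<in> Y \<Longrightarrow> d' a x = s x * 0 x"
      "\<not> algebraic_on Y A g \<Longrightarrow> \<not> zero_on Y (d' g)"
    with g subalgebra_adjoin[OF A(1)] adjoin_subset[OF sub A(2) g(1)] show ?case
      by (intro exI[of _ "adjoin A g"] exI[of _ d']) (auto simp: zero_on_def)
  qed
next
  case (insert l T)
  then obtain B d where B: "subalgebra B" "B \<subseteq> S" "A \<subseteq> B" "g \<in> B" "c ` T \<subseteq> B"
    and d: "derivation_on Y S B d" "\<forall>a\<in>A. zero_on Y (d a)" "\<not> zero_on Y (d g)" by auto
  have l: "c l \<in> S" using insert by simp
  from B(1,2) d(1) l show ?case
  proof (rule extend_derivation)
    fix s d'
    assume s: "s \<in> S" "\<not> zero_on Y s" and d': "derivation_on Y S (adjoin B (c l)) d'"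
      "\<And>a x. a \<in> B \<Longrightarrow> x \<in> Y \<Longrightarrow> d' a x = s x * d a x"
    have "\<not> zero_on Y (s * d g)"
      using no_zero_divisors[OF s(1) derivation_onD(1)[OF d(1) B(4)]] s(2) d(3) by blast
    then have g': "\<not> zero_on Y (d' g)"
      using d'(2)[OF B(4)] by (simp add: zero_on_def)
    have A': "\<forall>a\<in>A. zero_on Y (d' a)"
      using d'(2) d(2) B(3) by (auto simp: zero_on_def)
    show ?case
      using B subalgebra_adjoin[OF B(1), of "c l"] adjoin_subset[OF sub B(2) l] d'(1) A' g'
      by (intro exI[of _ "adjoin B (c l)"] exI[of _ d'] conjI) auto
  qed
qed

end

lemma derivation_poly:
  assumes S: "subalgebra S" and d: "derivation_on Y S S d" and g: "g \<in> S" and x: "x \<in> Y" and P: "P \<in> polys S"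
  shows "d (poly P g) x = lift_deriv d 1 (d g) g P x"
  using P
proof (induction P)
  case 0
  then show ?case using derivation_onD(3)[OF d x, of 0] by (simp add: lift_deriv_0[OF S d x])
next
  case (pCons a P)
  note aP = polys_pConsD[OF pCons.prems]
  have mem: "poly P g \<in> S" "g * poly P g \<in> S"
    by (intro subalgebra_closed(6)[OF S] g poly_in_subalgebra[OF S aP(2) g])+
  show ?case
    unfolding poly_pCons lift_deriv_pCons[OF S d x pCons.prems] derivation_onD(5)[OF d aP(1) mem(2) x]
      derivation_onD(6)[OF d g mem(1) x] pCons.IH[OF aP(2)]
    by (simp add: algebra_simps)
qed

section \<open>Algebraic dependence between polynomial functions\<close>

lemma subalgebra_polynomial_fun: "subalgebra (Collect polynomial_fun)"
  by (simp add: subalgebra_def polynomial_fun_const polynomial_fun_add polynomial_fun_mult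
      plus_fun_def times_fun_def)

text \<open>The algebra generated by the components of \<open>h\<close>.\<close>

definition pullback :: "('k::real_normed_field ^ 'n \<Rightarrow> 'k ^ 's) \<Rightarrow> ('k ^ 'n \<Rightarrow> 'k) set" where
  "pullback h = {\<lambda>x. q (h x) | q. polynomial_fun q}"

lemma pullbackI: "polynomial_fun q \<Longrightarrow> (\<lambda>x. q (h x)) \<in> pullback h"
  unfolding pullback_def by blast

lemma subalgebra_pullback: "subalgebra (pullback h)"
  unfolding subalgebra_def
proof (intro conjI allI ballI)
  show "(\<lambda>_. c) \<in> pullback h" for c
    by (rule pullbackI) (rule polynomial_fun_const)
  fix p q assume "p \<in> pullback h" "q \<in> pullback h"
  then obtain p' q' where "p = (\<lambda>x. p' (h x))" "polynomial_fun p'" "q = (\<lambda>x. q' (h x))" "polynomial_fun q'"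
    unfolding pullback_def by blast
  then show "p + q \<in> pullback h" "p * q \<in> pullback h"
    unfolding pullback_def mem_Collect_eq
    by (intro exI[of _ "\<lambda>y. p' y + q' y"] exI[of _ "\<lambda>y. p' y * q' y"];
        simp add: plus_fun_def times_fun_def polynomial_fun_intros)+
qed

lemma pullback_subset: "polynomial_map h \<Longrightarrow> pullback h \<subseteq> Collect polynomial_fun"
  unfolding pullback_def using polynomial_fun_compose by fastforce

text \<open>The criterion for algebraic dependence. A derivation of all polynomial functions is determined by its
values at the coordinates, that is, by a vector field; preserving the functions that vanish on \<open>Y\<close>
means being tangent to \<open>Y\<close>.\<close>

lemma algebraic_on_vector_field:
  fixes h :: "'k::real_normed_field ^ 'n \<Rightarrow> 'k ^ 's"
  assumes Y: "function_domain Y (Collect polynomial_fun)"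
    and h: "polynomial_map h" and g: "polynomial_fun g"
    and vf: "\<And>v. polynomial_map v \<Longrightarrow>
        (\<And>p x. polynomial_fun p \<Longrightarrow> zero_on Y p \<Longrightarrow> x \<in> Y \<Longrightarrow> dderiv p x (v x) = 0) \<Longrightarrow>
        (\<And>j x. x \<in> Y \<Longrightarrow> dderiv (\<lambda>x. h x $ j) x (v x) = 0) \<Longrightarrow>
        zero_on Y (\<lambda>x. dderiv g x (v x))"
  shows "algebraic_on Y (pullback h) g"
proof (rule ccontr)
  interpret function_domain Y "Collect polynomial_fun" by (rule Y)
  assume "\<not> algebraic_on Y (pullback h) g"
  then have "\<exists>B d. subalgebra B \<and> B \<subseteq> Collect polynomial_fun \<and> pullback h \<subseteq> B \<and> g \<in> B \<and>
      (\<lambda>l x. x $ l) ` UNIV \<subseteq> B \<and> derivation_on Y (Collect polynomial_fun) B d \<and>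
      (\<forall>a\<in>pullback h. zero_on Y (d a)) \<and> \<not> zero_on Y (d g)"
    using g by (intro derivation_adjoin_finite subalgebra_pullback pullback_subset h)
      (auto simp: polynomial_fun_coord)
  then obtain B d where B: "subalgebra B" "(\<lambda>l x. x $ l) ` UNIV \<subseteq> B"
    and d: "derivation_on Y (Collect polynomial_fun) B d"
    and dh: "\<forall>a\<in>pullback h. zero_on Y (d a)" and dg: "\<not> zero_on Y (d g)"
    by (elim exE conjE)
  have PB: "p \<in> B" if "polynomial_fun p" for p
    by (rule subalgebra_contains_polynomials[OF that]) (use B in \<open>auto intro: subalgebra_closed[OF B(1)]\<close>)
  define v where "v x = (\<chi> l. d (\<lambda>x. x $ l) x)" for x
  have v: "polynomial_map v"
    using derivation_onD(1)[OF d PB[OF polynomial_fun_coord]] by (simp add: polynomial_map_def v_def)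
  have eq: "d p x = dderiv p x (v x)" if "polynomial_fun p" and x: "x \<in> Y" for p x
    using that(1)
  proof (induction rule: polynomial_fun_induct)
    case (const c)
    then show ?case using derivation_onD(3)[OF d x] by simp
  next
    case (coord l)
    then show ?case by (simp add: v_def)
  next
    case (add p q)
    then show ?case
      using derivation_onD(5)[OF d PB PB x, of p q] by (simp add: dderiv_add plus_fun_def)
  next
    case (mult p q)
    then show ?case
      using derivation_onD(6)[OF d PB PB x, of p q] by (simp add: dderiv_mult times_fun_def)
  qed
  have "zero_on Y (\<lambda>x. dderiv g x (v x))"
  proof (rule vf[OF v])
    show "dderiv p x (v x) = 0" if "polynomial_fun p" "zero_on Y p" "x \<in> Y" for p x
      using derivation_onD(2)[OF d PB[OF that(1)] that(2)] eq[OF that(1,3)] that(3) by (simp add: zero_on_def)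
    show "dderiv (\<lambda>x. h x $ j) x (v x) = 0" if x: "x \<in> Y" for j x
    proof -
      have "polynomial_fun (\<lambda>x. h x $ j)" using h by (simp add: polynomial_map_def)
      moreover have "(\<lambda>x. h x $ j) \<in> pullback h"
        by (rule pullbackI) (rule polynomial_fun_coord)
      ultimately show ?thesis using dh x eq by (auto simp: zero_on_def)
    qed
  qed
  with dg eq[OF g] show False by (simp add: zero_on_def)
qed

text \<open>A converse of the preceding criterion on affine space: differentiating a minimal relation \<open>Q(g) = 0\<close> in a direction that
kills \<open>h\<close> leaves \<open>Q'(g) dg = 0\<close>, and \<open>Q'(g)\<close> is generically nonzero.\<close>

lemma algebraic_on_kernel:
  fixes h :: "'k::real_normed_field ^ 'n \<Rightarrow> 'k ^ 's"
  assumes h: "polynomial_map h" and g: "polynomial_fun g" and alg: "algebraic_on UNIV (pullback h) g"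
  obtains s where "polynomial_fun s" "\<not> zero_on UNIV s"
    "\<And>x v. s x \<noteq> 0 \<Longrightarrow> (\<And>j. dderiv (\<lambda>x. h x $ j) x v = 0) \<Longrightarrow> dderiv g x v = 0"
proof -
  let ?S = "Collect polynomial_fun :: ('k ^ 'n \<Rightarrow> 'k) set"
  obtain Q where Q: "Q \<in> polys (pullback h)" "zero_on UNIV (poly Q g)" "\<not> zero_on UNIV (formal_deriv g Q)"
    using algebraic_on_minimal[OF subalgebra_pullback alg] by metis
  have QS: "Q \<in> polys ?S"
    using Q(1) pullback_subset[OF h] by (auto simp: polys_def)
  have "formal_deriv g Q \<in> ?S"
    unfolding formal_deriv_def using g
    by (intro subalgebra_closed[OF subalgebra_polynomial_fun] coeff_in[OF QS]) auto
  then have pf: "polynomial_fun (formal_deriv g Q)" by simp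
  have ker: "dderiv g x v = 0" if s: "formal_deriv g Q x \<noteq> 0" and v: "\<And>j. dderiv (\<lambda>x. h x $ j) x v = 0" for x v
  proof -
    define d :: "('k ^ 'n \<Rightarrow> 'k) \<Rightarrow> 'k ^ 'n \<Rightarrow> 'k" where "d p y = dderiv p y v" for p y
    have d: "derivation_on UNIV ?S ?S d"
      unfolding derivation_on_def
    proof (intro conjI ballI allI impI)
      fix p assume p: "p \<in> ?S"
      then show "d p \<in> ?S" unfolding d_def by (simp add: polynomial_fun_dderiv_const)
      show "zero_on UNIV (d p)" if "zero_on UNIV p"
      proof -
        have "p = (\<lambda>_. 0)" using that by (auto simp: zero_on_def)
        then show ?thesis by (simp add: d_def zero_on_def)
      qed
      fix q y assume "q \<in> ?S"
      with p show "d (p + q) y = d p y + d q y" "d (p * q) y = p y * d q y + d p y * q y"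
        by (simp_all add: d_def plus_fun_def times_fun_def dderiv_add dderiv_mult)
    qed (simp add: d_def zero_on_def)
    have zero: "dderiv q y 0 = 0" if "polynomial_fun q" for q :: "'k ^ 's \<Rightarrow> 'k" and y
      by (subst dderiv_expand[OF that]) simp
    have dQ: "d (coeff Q i) x = 0" for i
    proof -
      obtain q where q: "polynomial_fun q" "coeff Q i = (\<lambda>x. q (h x))"
        using coeff_in[OF Q(1), of i] unfolding pullback_def by blast
      have "(\<chi> j. dderiv (\<lambda>x. h x $ j) x v) = 0" by (simp add: vec_eq_iff v)
      then show ?thesis
        unfolding d_def q(2) dderiv_compose[OF q(1) h] by (simp add: zero[OF q(1)])
    qed
    have "poly Q g \<in> ?S" by (rule poly_in_subalgebra[OF subalgebra_polynomial_fun QS]) (simp add: g)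
    then have "0 = d (poly Q g) x"
      using derivation_onD(2)[OF d _ Q(2)] by (simp add: zero_on_def)
    also have "\<dots> = lift_deriv d 1 (d g) g Q x"
      using g by (intro derivation_poly[OF subalgebra_polynomial_fun d _ _ QS]) auto
    also have "\<dots> = d g x * formal_deriv g Q x"
      by (simp add: lift_deriv_def coeff_deriv_def dQ)
    finally show ?thesis using s by (simp add: d_def)
  qed
  show ?thesis by (rule that[OF pf Q(3) ker])
qed

section \<open>Irreducibility\<close>

lemma algebraic_set_zeros: "polynomial_fun p \<Longrightarrow> algebraic_set {x. p x = 0}"
  unfolding algebraic_set_def by (intro exI[of _ "{p}"]) auto

lemma algebraic_set_Inter:
  assumes "\<And>V. V \<in> \<V> \<Longrightarrow> algebraic_set V"
  shows "algebraic_set (\<Inter>\<V>)"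
proof -
  let ?P = "{p. polynomial_fun p \<and> (\<exists>V\<in>\<V>. \<forall>x\<in>V. p x = 0)}"
  have "x \<in> V" if x: "\<forall>p\<in>?P. p x = 0" and V: "V \<in> \<V>" for x V
  proof -
    obtain P where P: "\<forall>p\<in>P. polynomial_fun p" "V = {x. \<forall>p\<in>P. p x = 0}"
      using assms[OF V] unfolding algebraic_set_def by blast
    have "p x = 0" if p: "p \<in> P" for p
    proof -
      have "\<forall>y\<in>V. p y = 0" using p by (simp add: P(2))
      with P(1) p V x show ?thesis by auto
    qed
    then show ?thesis by (simp add: P(2))
  qed
  then have "\<Inter>\<V> = {x. \<forall>p\<in>?P. p x = 0}" by (intro equalityI subsetI) auto
  then show ?thesis unfolding algebraic_set_def by (intro exI[of _ ?P]) auto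
qed

lemma zariski_closure_facts:
  shows "algebraic_set (zariski_closure X)" "X \<subseteq> zariski_closure X"
    and "algebraic_set V \<Longrightarrow> X \<subseteq> V \<Longrightarrow> zariski_closure X \<subseteq> V"
proof -
  show "algebraic_set (zariski_closure X)"
    unfolding zariski_closure_def by (rule hull_in) (rule algebraic_set_Inter, simp)
  show "X \<subseteq> zariski_closure X"
    unfolding zariski_closure_def by (rule hull_subset)
  show "algebraic_set V \<Longrightarrow> X \<subseteq> V \<Longrightarrow> zariski_closure X \<subseteq> V"
    unfolding zariski_closure_def by (rule hull_minimal)
qed

lemma function_domain_irreducible:
  assumes X: "irreducible_variety X"
  shows "function_domain X (Collect polynomial_fun)"
proof
  show "subalgebra (Collect polynomial_fun :: ('a ^ 'b \<Rightarrow> 'a) set)" by (rule subalgebra_polynomial_fun)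
  show "X \<noteq> {}" using X by (simp add: irreducible_variety_def)
  fix p q :: "'a ^ 'b \<Rightarrow> 'a"
  assume pq: "p \<in> Collect polynomial_fun" "q \<in> Collect polynomial_fun" and z: "zero_on X (p * q)"
  have alg: "algebraic_set (X \<inter> {x. r x = 0})" if "polynomial_fun r" for r
    using algebraic_set_Inter[of "{X, {x. r x = 0}}"] X algebraic_set_zeros[OF that]
    by (auto simp: irreducible_variety_def)
  let ?A = "X \<inter> {x. p x = 0}" and ?B = "X \<inter> {x. q x = 0}"
  have "X = ?A \<union> ?B"
    using z by (auto simp: zero_on_def)
  moreover have "\<not> (\<exists>A B. algebraic_set A \<and> algebraic_set B \<and> A \<subset> X \<and> B \<subset> X \<and> X = A \<union> B)"
    using X unfolding irreducible_variety_def by (elim conjE)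
  moreover have "algebraic_set ?A" "algebraic_set ?B"
    using alg pq by simp_all
  ultimately have "\<not> (?A \<subset> X \<and> ?B \<subset> X)"
    by meson
  then show "zero_on X p \<or> zero_on X q" by (auto simp: zero_on_def)
qed

lemma polynomial_fun_line:
  assumes "polynomial_fun p"
  shows "\<exists>P. \<forall>t. p (a + t *s b) = poly P t"
  using assms
proof (induction rule: polynomial_fun_induct)
  case (const c)
  show ?case by (rule exI[of _ "[:c:]"]) simp
next
  case (coord l)
  show ?case by (rule exI[of _ "[:a $ l, b $ l:]"]) simp
next
  case (add p q)
  then show ?case by (metis poly_add)
next
  case (mult p q)
  then show ?case by (metis poly_mult)
qed

text \<open>Nonzero values at \<open>x\<close> and \<open>y\<close> are separated already on the line through \<open>x\<close> and \<open>y\<close>, where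
polynomial functions become polynomials in one variable over an infinite field.\<close>

lemma function_domain_UNIV: "function_domain UNIV (Collect polynomial_fun)"
proof
  show "subalgebra (Collect polynomial_fun :: ('a ^ 'b \<Rightarrow> 'a) set)" by (rule subalgebra_polynomial_fun)
  fix p q :: "'a ^ 'b \<Rightarrow> 'a"
  assume pq: "p \<in> Collect polynomial_fun" "q \<in> Collect polynomial_fun" and z: "zero_on UNIV (p * q)"
  show "zero_on UNIV p \<or> zero_on UNIV q"
  proof (rule ccontr)
    assume "\<not> ?thesis"
    then obtain x y where xy: "p x \<noteq> 0" "q y \<noteq> 0" by (auto simp: zero_on_def)
    obtain P where P: "\<And>t. p (x + t *s (y - x)) = poly P t" using polynomial_fun_line pq by blast
    obtain Q where Q: "\<And>t. q (x + t *s (y - x)) = poly Q t" using polynomial_fun_line pq by blast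
    have "P \<noteq> 0" "Q \<noteq> 0" using P[of 0] Q[of 1] xy by auto
    moreover have "poly (P * Q) t = 0" for t
      using z P[of t] Q[of t] by (simp add: zero_on_def flip: P Q)
    then have "P * Q = 0" using poly_all_0_iff_0 by blast
    ultimately show False by simp
  qed
qed simp

lemma irreducible_closure_range:
  assumes \<psi>: "polynomial_map \<psi>"
  shows "irreducible_variety (zariski_closure (range \<psi>))"
  unfolding irreducible_variety_def
proof (intro conjI notI)
  interpret function_domain UNIV "Collect polynomial_fun" by (rule function_domain_UNIV)
  let ?C = "zariski_closure (range \<psi>)"
  show "algebraic_set ?C" by (rule zariski_closure_facts)
  show False if "?C = {}" using that zariski_closure_facts(2)[of "range \<psi>"] by auto
  assume "\<exists>A B. algebraic_set A \<and> algebraic_set B \<and> A \<subset> ?C \<and> B \<subset> ?C \<and> ?C = A \<union> B"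
  then obtain A B where AB: "algebraic_set A" "algebraic_set B" "A \<subset> ?C" "B \<subset> ?C" "?C = A \<union> B" by blast
  have sep: "\<exists>p. polynomial_fun p \<and> (\<forall>x\<in>V. p x = 0) \<and> \<not> zero_on UNIV (\<lambda>t. p (\<psi> t))"
    if V: "algebraic_set V" "V \<subset> ?C" for V
  proof -
    have "\<not> range \<psi> \<subseteq> V" using zariski_closure_facts(3)[OF V(1)] V(2) by blast
    then obtain t where t: "\<psi> t \<notin> V" by blast
    obtain P where P: "\<forall>p\<in>P. polynomial_fun p" "V = {x. \<forall>p\<in>P. p x = 0}"
      using V(1) unfolding algebraic_set_def by blast
    with t obtain p where "p \<in> P" "p (\<psi> t) \<noteq> 0" by auto
    with P show ?thesis by (intro exI[of _ p]) (auto simp: zero_on_def)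
  qed
  obtain p where p: "polynomial_fun p" "\<forall>x\<in>A. p x = 0" "\<not> zero_on UNIV (\<lambda>t. p (\<psi> t))"
    using sep[OF AB(1,3)] by blast
  obtain q where q: "polynomial_fun q" "\<forall>x\<in>B. q x = 0" "\<not> zero_on UNIV (\<lambda>t. q (\<psi> t))"
    using sep[OF AB(2,4)] by blast
  have "\<psi> t \<in> A \<union> B" for t using AB(5) zariski_closure_facts(2)[of "range \<psi>"] by blast
  then have "zero_on UNIV ((\<lambda>t. p (\<psi> t)) * (\<lambda>t. q (\<psi> t)))"
    using p(2) q(2) by (auto simp: zero_on_def)
  then show False
    using no_zero_divisors[of "\<lambda>t. p (\<psi> t)" "\<lambda>t. q (\<psi> t)"] p q polynomial_fun_compose[OF _ \<psi>] by auto
qed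

section \<open>Generic finiteness of fibres\<close>

lemma (in function_domain) prod_nonzero:
  assumes "finite I" "\<And>i. i \<in> I \<Longrightarrow> F i \<in> S \<and> \<not> zero_on Y (F i)"
  shows "(\<lambda>x. \<Prod>i\<in>I. F i x) \<in> S \<and> \<not> zero_on Y (\<lambda>x. \<Prod>i\<in>I. F i x)"
  using assms
proof (induction I)
  case empty
  show ?case using subalgebra_closed(1)[OF sub, of 1] nonempty by (auto simp: zero_on_def)
next
  case (insert i I)
  then show ?case
    using no_zero_divisors[of "F i" "\<lambda>x. \<Prod>i\<in>I. F i x"] subalgebra_closed(6)[OF sub, of "F i" "\<lambda>x. \<Prod>i\<in>I. F i x"]
    by (auto simp: times_fun_def)
qed

text \<open>For each \<open>l\<close> let \<open>i l\<close> be the index of a coefficient of the relation for \<open>\<phi>\<^sub>l\<close> that is not identically zero on \<open>Y\<close>.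
Outside the zeros of the product \<open>e\<close> of these coefficients, the \<open>l\<close>-th coordinates of the points in
a fibre are roots of one nonzero polynomial.\<close>

lemma generically_recoverableI:
  fixes \<phi> :: "'k::real_normed_field ^ 'l \<Rightarrow> 'k ^ 'n" and \<mu> :: "'k ^ 'n \<Rightarrow> 'k ^ 's"
  assumes Y: "function_domain Y (Collect polynomial_fun)"
    and \<phi>: "polynomial_map \<phi>" and \<mu>: "polynomial_map \<mu>"
    and alg: "\<And>l. algebraic_on Y (pullback (\<lambda>t. \<mu> (\<phi> t))) (\<lambda>t. \<phi> t $ l)"
  shows "generically_recoverable \<mu> (\<phi> ` Y)"
proof -
  interpret function_domain Y "Collect polynomial_fun" by (rule Y)
  let ?h = "\<lambda>t. \<mu> (\<phi> t)"
  obtain P i where P: "\<And>l. P l \<in> polys (pullback ?h)" "\<And>l. zero_on Y (poly (P l) (\<lambda>t. \<phi> t $ l))"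
    and i: "\<And>l. \<not> zero_on Y (coeff (P l) (i l))"
    using alg unfolding algebraic_on_def by metis
  have "\<forall>l j. \<exists>q. polynomial_fun q \<and> coeff (P l) j = (\<lambda>t. q (?h t))"
    using coeff_in[OF P(1)] unfolding pullback_def by blast
  then obtain q where q: "\<And>l j. polynomial_fun (q l j)" "\<And>l j. coeff (P l) j = (\<lambda>t. q l j (?h t))"
    by metis
  define e where "e x = (\<Prod>l\<in>UNIV. q l (i l) (\<mu> x))" for x
  define U where "U = zariski_closure (\<phi> ` Y) - {x. e x = 0}"
  have "polynomial_fun e"
    unfolding e_def by (rule polynomial_fun_prod) (rule polynomial_fun_compose[OF q(1) \<mu>])
  then have "zariski_open_in (zariski_closure (\<phi> ` Y)) U"
    unfolding U_def zariski_open_in_def by (intro exI[of _ "{x. e x = 0}"] conjI algebraic_set_zeros) simp_all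
  moreover have "U \<noteq> {}"
  proof -
    have "\<not> zero_on Y (\<lambda>t. \<Prod>l\<in>UNIV. coeff (P l) (i l) t)"
      using i coeff_in[OF P(1)] pullback_subset[OF polynomial_map_compose[OF \<mu> \<phi>]]
      by (intro conjunct2[OF prod_nonzero]) auto
    then obtain t where "t \<in> Y" "e (\<phi> t) \<noteq> 0"
      by (auto simp: zero_on_def e_def q)
    then show ?thesis
      unfolding U_def using zariski_closure_facts(2)[of "\<phi> ` Y"] by blast
  qed
  moreover have "recoverable_at \<mu> (\<phi> ` Y) x" if "x \<in> \<phi> ` Y \<inter> U" for x
  proof -
    define p where "p l = (\<Sum>j\<le>degree (P l). monom (q l j (\<mu> x)) j)" for l
    have "p l \<noteq> 0" for l
    proof -
      have "coeff (P l) (i l) \<noteq> 0" using i[of l] by (auto simp: zero_on_def)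
      then have "i l \<le> degree (P l)" by (rule le_degree)
      moreover have "q l (i l) (\<mu> x) \<noteq> 0" using that by (auto simp: U_def e_def)
      ultimately have "coeff (p l) (i l) \<noteq> 0"
        by (simp add: p_def coeff_sum coeff_monom)
      then show ?thesis by auto
    qed
    then have fin: "finite {a. poly (p l) a = 0}" for l by (rule poly_roots_finite)
    have "{z \<in> \<phi> ` Y. \<mu> z = \<mu> x} \<subseteq> vec_lambda ` (\<Pi>\<^sub>E l\<in>UNIV. {a. poly (p l) a = 0})"
    proof
      fix z assume "z \<in> {z \<in> \<phi> ` Y. \<mu> z = \<mu> x}"
      then obtain t where t: "t \<in> Y" "z = \<phi> t" "\<mu> z = \<mu> x" by blast
      have "poly (p l) (z $ l) = 0" for l
        using P(2)[of l] t
        by (simp add: zero_on_def p_def poly_sum poly_monom poly_fun_apply[OF lessI] lessThan_Suc_atMost q flip: t(3))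
      then show "z \<in> vec_lambda ` (\<Pi>\<^sub>E l\<in>UNIV. {a. poly (p l) a = 0})"
        by (intro image_eqI[of _ _ "vec_nth z"]) auto
    qed
    then show ?thesis
      unfolding recoverable_at_def by (rule finite_subset) (intro finite_imageI finite_PiE fin finite)
  qed
  ultimately show ?thesis unfolding generically_recoverable_def by (intro exI[of _ U] conjI) auto
qed

section \<open>Rank and nullity\<close>

definition nullity :: "'a::field ^ 'n ^ 'm \<Rightarrow> nat" where
  "nullity A = vec.dim {v. A *v v = 0}"

lemma vec_subspace_kernel: "vec.subspace {v. A *v v = 0}"
  for A :: "'a::field ^ 'n ^ 'm"
  by (rule vec.subspace_kernel)

lemma vec_subspace_range: "vec.subspace (range ((*v) A))"
  for A :: "'a::field ^ 'n ^ 'm"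
  using vec.subspace_image[OF vec.subspace_UNIV] .

lemma dim_range_plus_nullity:
  fixes A :: "'a::field ^ 'n ^ 'm"
  shows "vec.dim (range ((*v) A)) + nullity A = CARD('n)"
proof -
  obtain g where g: "Vector_Spaces.linear (*s) (*s) g" "\<And>w. w \<in> range ((*v) A) \<Longrightarrow> A *v g w = w"
    using vec.linear_exists_right_inverse_on[OF matrix_vector_mul_linear_gen vec.subspace_UNIV, of A] by blast
  interpret g: Vector_Spaces.linear "(*s)" "(*s)" g by (rule g)
  let ?K = "{v. A *v v = 0}" and ?W = "g ` range ((*v) A)"
  have span: "vec.span (range ((*v) A)) = range ((*v) A)"
    using vec_subspace_range by simp
  have "inj_on g (range ((*v) A))"
    by (rule inj_on_inverseI[of _ "(*v) A"]) (rule g)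
  then have dimW: "vec.dim ?W = vec.dim (range ((*v) A))"
    by (intro vec.dim_image_eq g) (simp only: span)
  have "{x + y | x y. x \<in> ?W \<and> y \<in> ?K} = UNIV"
  proof -
    have "v = g (A *v v) + (v - g (A *v v))" "A *v (v - g (A *v v)) = 0" for v
      by (simp_all add: matrix_vector_mult_diff_distrib g)
    then show ?thesis by blast
  qed
  moreover have "?W \<inter> ?K = {0}"
    using g(2) by (auto simp: g.zero intro!: image_eqI[of _ _ 0] range_eqI[of _ _ 0])
  moreover have "vec.subspace ?W"
    by (intro g.subspace_image vec_subspace_range)
  ultimately have "vec.dim (UNIV :: ('a ^ 'n) set) + vec.dim {0 :: 'a ^ 'n} = vec.dim ?W + vec.dim ?K"
    using vec.dim_sums_Int[of ?W ?K] vec_subspace_kernel[of A] by simp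
  then show ?thesis by (simp add: dimW nullity_def card_cart_basis)
qed

text \<open>Expanding the columns of \<open>A\<close> in a basis of the column space writes each row of \<open>A\<close> as a combination of
the coefficient vectors \<open>r b\<close>, one for each basis element.\<close>

lemma dim_rows_le_dim_range:
  fixes A :: "'a::field ^ 'n ^ 'm"
  shows "vec.dim (rows A) \<le> vec.dim (range ((*v) A))"
proof -
  obtain B where B: "B \<subseteq> range ((*v) A)" "vec.independent B" "range ((*v) A) \<subseteq> vec.span B"
    "card B = vec.dim (range ((*v) A))"
    using vec.basis_exists by blast
  have fin: "finite B" using B(2) by (rule vec.finiteI_independent)
  define r where "r b = (\<chi> j. vec.representation B (A *v axis j 1) b)" for b
  have "row i A = (\<Sum>b\<in>B. (b $ i) *s r b)" for i
  proof (rule vec_eq_iff[THEN iffD2], rule allI)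
    fix j
    have "A *v axis j 1 \<in> vec.span B" using B(3) by blast
    from vec.sum_representation_eq[OF B(2) this fin order.refl]
    have "A *v axis j 1 = (\<Sum>b\<in>B. vec.representation B (A *v axis j 1) b *s b)" by simp
    then have "(A *v axis j 1) $ i = (\<Sum>b\<in>B. vec.representation B (A *v axis j 1) b *s b) $ i" by simp
    moreover have "(A *v axis j 1) $ i = row i A $ j"
      by (simp add: matrix_vector_mult_def row_def axis_def if_distrib sum.delta cong: if_cong)
    ultimately show "row i A $ j = (\<Sum>b\<in>B. (b $ i) *s r b) $ j"
      by (simp add: r_def mult.commute)
  qed
  moreover have "(\<Sum>b\<in>B. (b $ i) *s r b) \<in> vec.span (r ` B)" for i
    by (intro vec.span_sum vec.span_scale vec.span_base imageI)
  ultimately have "rows A \<subseteq> vec.span (r ` B)"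
    unfolding rows_def by auto
  then have "vec.dim (rows A) \<le> card (r ` B)"
    using fin by (intro vec.dim_le_card) auto
  also have "\<dots> \<le> card B" by (rule card_image_le[OF fin])
  finally show ?thesis using B(4) by simp
qed

text \<open>The definition of \<open>rank\<close> refers to rows; applying the preceding inequality to \<open>A\<close> and to its transpose
identifies it with the dimension of the range over any field.\<close>

lemma rank_plus_nullity:
  fixes A :: "'a::field ^ 'n ^ 'm"
  shows "rank A + nullity A = CARD('n)"
proof -
  have col: "vec.dim (range ((*v) B)) \<le> vec.dim (columns B)" for B :: "'a ^ 'p ^ 'q"
    by (rule vec.dim_mono) (auto intro: matrix_vector_mult_in_columnspace_gen)
  have "vec.dim (range ((*v) A)) \<le> vec.dim (rows (transpose A))"
    using col[of A] by simp
  also have "\<dots> \<le> vec.dim (range ((*v) (transpose A)))" by (rule dim_rows_le_dim_range)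
  also have "\<dots> \<le> rank A" using col[of "transpose A"] by (simp add: row_rank_def_gen)
  finally have "rank A = vec.dim (range ((*v) A))"
    using dim_rows_le_dim_range[of A] by (simp add: row_rank_def_gen)
  then show ?thesis using dim_range_plus_nullity[of A] by simp
qed

lemma nullity_mono:
  "(\<And>v. A *v v = 0 \<Longrightarrow> B *v v = 0) \<Longrightarrow> nullity A \<le> nullity B"
  unfolding nullity_def by (intro vec.dim_subset) auto

lemma kernel_eqI:
  assumes "\<And>v. A *v v = 0 \<Longrightarrow> B *v v = 0" "nullity B \<le> nullity A" "B *v v = 0"
  shows "A *v v = 0"
proof -
  have "{v. A *v v = 0} = {v. B *v v = 0}"
    using assms(1,2) by (intro vec.subspace_dim_equal vec_subspace_kernel) (auto simp: nullity_def)
  with assms(3) show ?thesis by blast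
qed

lemma exists_projection:
  fixes V :: "('a::field ^ 'n) set"
  assumes "vec.subspace V"
  obtains M :: "'a ^ 'n ^ 'n" where "\<And>v. v \<in> V \<Longrightarrow> M *v v = v" "\<And>v. M *v v \<in> V"
proof -
  obtain g where g: "g ` UNIV \<subseteq> V" "Vector_Spaces.linear (*s) (*s) g" "\<forall>v\<in>V. g v = v"
    using vec.linear_exists_left_inverse_on[OF vec.linear_ident assms] by auto
  show ?thesis by (rule that[of "matrix g"]) (use g in \<open>auto simp: matrix_works\<close>)
qed

lemma stack_matrix_mult_eq_0: "stack_matrix A B *v v = 0 \<longleftrightarrow> A *v v = 0 \<and> B *v v = 0"
  by (auto simp: vec_eq_iff matrix_vector_mult_def stack_matrix_def split: sum.split sum.split_asm)

section \<open>Genericity\<close>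

text \<open>With \<open>B\<close> a left inverse at \<open>t0\<close>, the polynomial \<open>det (B A(t))\<close> is nonzero at \<open>t0\<close>, and where it is nonzero \<open>A(t)\<close>
is injective. A single constant matrix \<open>B\<close> thus replaces a choice of minors.\<close>

lemma generic_injective:
  fixes A :: "'k::real_normed_field ^ 'l \<Rightarrow> 'k ^ 'n ^ 'm"
  assumes A: "\<And>i j. polynomial_fun (\<lambda>t. A t $ i $ j)"
    and inj: "\<And>v. A t0 *v v = 0 \<Longrightarrow> v = 0"
  obtains s where "polynomial_fun s" "s t0 \<noteq> 0" "\<And>t v. s t \<noteq> 0 \<Longrightarrow> A t *v v = 0 \<Longrightarrow> v = 0"
proof -
  have "\<exists>B. B ** A t0 = mat 1"
    unfolding matrix_left_invertible_ker using inj by (intro allI impI)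
  then obtain B where B: "B ** A t0 = mat 1" by (elim exE)
  define s where "s t = det (B ** A t)" for t
  have "polynomial_fun (\<lambda>t. (B ** A t) $ i $ j)" for i j
    unfolding matrix_matrix_mult_def vec_lambda_beta
    by (rule polynomial_fun_sum) (rule polynomial_fun_mult[OF polynomial_fun_const A])
  then have "polynomial_fun s"
    unfolding s_def det_def
    by (intro polynomial_fun_sum polynomial_fun_mult[OF polynomial_fun_const] polynomial_fun_prod)
  moreover have "s t0 \<noteq> 0" by (simp add: s_def B)
  moreover have "v = 0" if st: "s t \<noteq> 0" and Av: "A t *v v = 0" for t v
  proof -
    have "invertible (B ** A t)" using st by (simp add: s_def invertible_det_nz)
    then obtain C where "C ** (B ** A t) = mat 1" unfolding invertible_def by blast
    moreover have "(C ** (B ** A t)) *v v = 0"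
      by (simp add: matrix_vector_mul_assoc[symmetric] Av)
    ultimately show ?thesis by simp
  qed
  ultimately show ?thesis by (rule that)
qed

text \<open>The rank is lower semicontinuous. Stacking \<open>A(t)\<close> with a projection \<open>P\<close> onto the kernel at \<open>t0\<close> gives a
matrix that is injective at \<open>t0\<close>, hence generically; then \<open>P\<close> embeds the kernel at \<open>t\<close> into the kernel
at \<open>t0\<close>.\<close>

lemma generic_nullity:
  fixes A :: "'k::real_normed_field ^ 'l \<Rightarrow> 'k ^ 'n ^ 'm"
  assumes A: "\<And>i j. polynomial_fun (\<lambda>t. A t $ i $ j)"
  obtains s where "polynomial_fun s" "s t0 \<noteq> 0" "\<And>t. s t \<noteq> 0 \<Longrightarrow> nullity (A t) \<le> nullity (A t0)"
proof -
  obtain P where P: "\<And>v. v \<in> {v. A t0 *v v = 0} \<Longrightarrow> P *v v = v" "\<And>v. P *v v \<in> {v. A t0 *v v = 0}"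
    using exists_projection[OF vec_subspace_kernel] by metis
  have ent: "polynomial_fun (\<lambda>t. stack_matrix (A t) P $ i $ j)" for i j
    by (cases i) (simp_all add: stack_matrix_def A polynomial_fun_const)
  have inj: "v = 0" if "stack_matrix (A t0) P *v v = 0" for v
    using that P(1)[of v] by (simp add: stack_matrix_mult_eq_0)
  obtain s where s: "polynomial_fun s" "s t0 \<noteq> 0"
    "\<And>t v. s t \<noteq> 0 \<Longrightarrow> stack_matrix (A t) P *v v = 0 \<Longrightarrow> v = 0"
    using generic_injective[of "\<lambda>t. stack_matrix (A t) P" t0, OF ent inj] by metis
  have "nullity (A t) \<le> nullity (A t0)" if t: "s t \<noteq> 0" for t
  proof -
    let ?K = "{v. A t *v v = 0}"
    have "inj_on ((*v) P) ?K"
    proof (rule inj_onI)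
      fix v w assume "v \<in> ?K" "w \<in> ?K" "P *v v = P *v w"
      then have "stack_matrix (A t) P *v (v - w) = 0"
        unfolding stack_matrix_mult_eq_0 by (simp add: matrix_vector_mult_diff_distrib)
      from s(3)[OF t this] show "v = w" by simp
    qed
    moreover have "vec.span ?K = ?K"
      using vec_subspace_kernel[of "A t"] by simp
    ultimately have "vec.dim ((*v) P ` ?K) = vec.dim ?K"
      by (intro vec.dim_image_eq matrix_vector_mul_linear_gen) (simp only:)
    moreover have "vec.dim ((*v) P ` ?K) \<le> vec.dim {v. A t0 *v v = 0}"
      using P(2) by (intro vec.dim_subset) blast
    ultimately show ?thesis by (simp add: nullity_def)
  qed
  with s(1,2) show ?thesis by (rule that)
qed

lemma polynomial_fun_jacobian:
  assumes "polynomial_map g"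
  shows "polynomial_fun (\<lambda>t. jacobian g (at t) $ i $ j)"
proof -
  have gi: "polynomial_fun (\<lambda>x. g x $ i)" using assms by (simp add: polynomial_map_def)
  have "jacobian g (at t) $ i $ j = (jacobian g (at t) *v axis j 1) $ i" for t
    by (simp add: matrix_vector_mult_def axis_def if_distrib sum.delta cong: if_cong)
  then show ?thesis
    by (simp add: jacobian_mult_nth[OF assms] polynomial_fun_dderiv_const[OF gi])
qed

lemma jacobian_mult_eq_0:
  assumes "polynomial_map g"
  shows "jacobian g (at x) *v v = 0 \<longleftrightarrow> (\<forall>i. dderiv (\<lambda>x. g x $ i) x v = 0)"
  by (simp add: vec_eq_iff jacobian_mult_nth[OF assms])

text \<open>The hypothesis forces \<open>ker d\<phi>\<close> and the larger space \<open>ker d(\<mu> \<circ> \<phi>)\<close> to have the same dimension at a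
generic point, so a vector field in the second kernel lies in the first.\<close>

lemma algebraic_on_generic_kernel:
  fixes \<phi> :: "'k::real_normed_field ^ 'l \<Rightarrow> 'k ^ 'n" and \<mu> :: "'k ^ 'n \<Rightarrow> 'k ^ 's"
  assumes \<phi>: "polynomial_map \<phi>" and \<mu>: "polynomial_map \<mu>"
    and nul: "\<And>t. nullity (jacobian (\<lambda>t. \<mu> (\<phi> t)) (at t0)) \<le> nullity (jacobian \<phi> (at t))"
  shows "algebraic_on UNIV (pullback (\<lambda>t. \<mu> (\<phi> t))) (\<lambda>t. \<phi> t $ l)"
proof (rule algebraic_on_vector_field)
  show "function_domain UNIV (Collect (polynomial_fun :: ('k ^ 'l \<Rightarrow> 'k) \<Rightarrow> bool))"
    by (rule function_domain_UNIV)
  then interpret function_domain UNIV "Collect (polynomial_fun :: ('k ^ 'l \<Rightarrow> 'k) \<Rightarrow> bool)" .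
  show h: "polynomial_map (\<lambda>t. \<mu> (\<phi> t))" by (rule polynomial_map_compose[OF \<mu> \<phi>])
  show \<phi>l: "polynomial_fun (\<lambda>t. \<phi> t $ l)" using \<phi> by (simp add: polynomial_map_def)
  fix v :: "'k ^ 'l \<Rightarrow> 'k ^ 'l"
  assume v: "polynomial_map v" and "\<And>j t. t \<in> UNIV \<Longrightarrow> dderiv (\<lambda>t. \<mu> (\<phi> t) $ j) t (v t) = 0"
  then have hv: "jacobian (\<lambda>t. \<mu> (\<phi> t)) (at t) *v v t = 0" for t
    by (simp add: jacobian_mult_eq_0[OF h])
  obtain s where s: "polynomial_fun s" "s t0 \<noteq> 0"
    "\<And>t. s t \<noteq> 0 \<Longrightarrow> nullity (jacobian (\<lambda>t. \<mu> (\<phi> t)) (at t)) \<le> nullity (jacobian (\<lambda>t. \<mu> (\<phi> t)) (at t0))"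
    using generic_nullity[of "\<lambda>t. jacobian (\<lambda>t. \<mu> (\<phi> t)) (at t)" t0, OF polynomial_fun_jacobian[OF h]] by metis
  have "dderiv (\<lambda>t. \<phi> t $ l) t (v t) = 0" if "s t \<noteq> 0" for t
  proof -
    have "jacobian \<phi> (at t) *v v t = 0"
    proof (rule kernel_eqI)
      show "jacobian (\<lambda>t. \<mu> (\<phi> t)) (at t) *v w = 0" if "jacobian \<phi> (at t) *v w = 0" for w
        using that by (simp add: jacobian_compose[OF \<mu> \<phi>])
      show "nullity (jacobian (\<lambda>t. \<mu> (\<phi> t)) (at t)) \<le> nullity (jacobian \<phi> (at t))"
        using s(3)[OF that] nul[of t] by simp
    qed (rule hv)
    then show ?thesis by (simp add: jacobian_mult_eq_0[OF \<phi>])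
  qed
  then have "zero_on UNIV (s * (\<lambda>t. dderiv (\<lambda>t. \<phi> t $ l) t (v t)))"
    by (auto simp: zero_on_def)
  then show "zero_on UNIV (\<lambda>t. dderiv (\<lambda>t. \<phi> t $ l) t (v t))"
    using no_zero_divisors[of s] s(1,2) polynomial_fun_dderiv[OF \<phi>l v] by (auto simp: zero_on_def)
qed

section \<open>The dimension of a parametrized variety\<close>

text \<open>A relation between \<open>\<psi>\<^sub>l\<close> and \<open>\<mu> \<circ> \<psi>\<close> says that a polynomial on the target vanishes on the image
of \<open>\<psi>\<close>, hence on its closure. The inclusion \<open>sub\<close> keeps the relation for \<open>\<psi>'\<close> nontrivial.\<close>

lemma algebraic_on_transfer:
  fixes \<psi> \<psi>' :: "'k::real_normed_field ^ 'l \<Rightarrow> 'k ^ 'n" and \<mu> :: "'k ^ 'n \<Rightarrow> 'k ^ 's"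
  assumes \<mu>: "polynomial_map \<mu>" and sub: "range \<psi> \<subseteq> range \<psi>'"
    and cl: "range \<psi>' \<subseteq> zariski_closure (range \<psi>)"
    and alg: "algebraic_on UNIV (pullback (\<lambda>t. \<mu> (\<psi> t))) (\<lambda>t. \<psi> t $ l)"
  shows "algebraic_on UNIV (pullback (\<lambda>t. \<mu> (\<psi>' t))) (\<lambda>t. \<psi>' t $ l)"
proof -
  obtain P i where P: "P \<in> polys (pullback (\<lambda>t. \<mu> (\<psi> t)))" "zero_on UNIV (poly P (\<lambda>t. \<psi> t $ l))"
    and i: "\<not> zero_on UNIV (coeff P i)"
    using alg unfolding algebraic_on_def by blast
  have "\<forall>j. \<exists>q. polynomial_fun q \<and> coeff P j = (\<lambda>t. q (\<mu> (\<psi> t)))"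
    using coeff_in[OF P(1)] unfolding pullback_def by blast
  then obtain q where q: "\<And>j. polynomial_fun (q j)" "\<And>j. coeff P j = (\<lambda>t. q j (\<mu> (\<psi> t)))"
    by metis
  let ?n = "Suc (degree P)"
  define F where "F x = (\<Sum>j<?n. q j (\<mu> x) * (\<Prod>k<j. x $ l))" for x
  have F: "polynomial_fun F"
    unfolding F_def
    by (intro polynomial_fun_sum polynomial_fun_mult polynomial_fun_prod polynomial_fun_coord
        polynomial_fun_compose[OF q(1) \<mu>])
  have "F (\<psi> t) = 0" for t
    using P(2) by (simp add: zero_on_def poly_fun_apply[OF lessI] F_def q)
  then have "range \<psi> \<subseteq> {x. F x = 0}" by blast
  from zariski_closure_facts(3)[OF algebraic_set_zeros[OF F] this] cl
  have F0: "F (\<psi>' t) = 0" for t by blast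
  define Q where "Q = (\<Sum>j<?n. monom (\<lambda>t. q j (\<mu> (\<psi>' t))) j)"
  have "Q \<in> polys (pullback (\<lambda>t. \<mu> (\<psi>' t)))"
    unfolding polys_def mem_Collect_eq Q_def coeff_sum coeff_monom
    by (intro allI subalgebra_closed(10)[OF subalgebra_pullback])
       (simp add: subalgebra_closed(2)[OF subalgebra_pullback] pullbackI[OF q(1)])
  moreover have "zero_on UNIV (poly Q (\<lambda>t. \<psi>' t $ l))"
    using F0 by (simp add: zero_on_def Q_def poly_sum poly_monom F_def)
  moreover have "\<not> zero_on UNIV (coeff Q i)"
  proof -
    obtain t where t: "q i (\<mu> (\<psi> t)) \<noteq> 0" using i by (auto simp: zero_on_def q)
    then have "coeff P i \<noteq> 0" by (auto simp: q fun_eq_iff)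
    then have "i < ?n" using le_degree[of P i] by simp
    moreover obtain t' where "\<psi> t = \<psi>' t'" using sub by blast
    ultimately have "coeff Q i t' \<noteq> 0"
      using t by (simp add: Q_def coeff_sum coeff_monom if_distrib[of "\<lambda>f. f t'"] sum.delta' cong: if_cong)
    then show ?thesis by (auto simp: zero_on_def)
  qed
  ultimately show ?thesis unfolding algebraic_on_def by (intro bexI[of _ Q] conjI exI[of _ i])
qed

text \<open>Let \<open>r\<close> be the maximal rank of \<open>d\<psi>\<close>, attained at \<open>t0\<close>, and project by \<open>M\<close> onto the \<open>r\<close>-dimensional range
there. The coordinates of \<open>\<psi>\<close> are algebraic over those of \<open>M \<psi>\<close>. If the closures were equal, the same
would hold for \<open>\<psi>'\<close>, and generically the kernel of \<open>d\<psi>'\<close> would contain that of \<open>d(M \<psi>')\<close>, whose rank is at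
most \<open>r\<close>; but \<open>d\<psi>'\<close> has larger rank.\<close>

lemma closure_neq_if_nullity:
  fixes \<psi> \<psi>' :: "'k::real_normed_field ^ 'l \<Rightarrow> 'k ^ 'n"
  assumes \<psi>: "polynomial_map \<psi>" and \<psi>': "polynomial_map \<psi>'" and subset: "range \<psi> \<subseteq> range \<psi>'"
    and max: "\<And>t. nullity (jacobian \<psi> (at t0)) \<le> nullity (jacobian \<psi> (at t))"
    and less: "nullity (jacobian \<psi>' (at t1)) < nullity (jacobian \<psi> (at t0))"
  shows "zariski_closure (range \<psi>) \<noteq> zariski_closure (range \<psi>')"
proof
  assume eq: "zariski_closure (range \<psi>) = zariski_closure (range \<psi>')"
  interpret function_domain UNIV "Collect (polynomial_fun :: ('k ^ 'l \<Rightarrow> 'k) \<Rightarrow> bool)"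
    by (rule function_domain_UNIV)
  let ?V = "range ((*v) (jacobian \<psi> (at t0)))"
  obtain M where M: "\<And>v. v \<in> ?V \<Longrightarrow> M *v v = v" "\<And>v. M *v v \<in> ?V"
    using exists_projection[OF vec_subspace_range] by metis
  have pM: "polynomial_map ((*v) M)" using polynomial_map_affine[of 0 M] by simp
  have JM: "jacobian ((*v) M) (at x) *v v = M *v v" for x v
    using jacobian_affine[of 0 M x v] by simp
  have "algebraic_on UNIV (pullback (\<lambda>t. M *v \<psi> t)) (\<lambda>t. \<psi> t $ l)" for l
  proof (rule algebraic_on_generic_kernel[OF \<psi> pM])
    have "nullity (jacobian (\<lambda>t. M *v \<psi> t) (at t0)) \<le> nullity (jacobian \<psi> (at t0))"
      by (rule nullity_mono) (simp add: jacobian_compose[OF pM \<psi>] JM M(1))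
    then show "nullity (jacobian (\<lambda>t. M *v \<psi> t) (at t0)) \<le> nullity (jacobian \<psi> (at t))" for t
      using max[of t] by simp
  qed
  then have alg: "algebraic_on UNIV (pullback (\<lambda>t. M *v \<psi>' t)) (\<lambda>t. \<psi>' t $ l)" for l
    using zariski_closure_facts(2)[of "range \<psi>'"] eq by (intro algebraic_on_transfer[OF pM subset]) auto
  have h: "polynomial_map (\<lambda>t. M *v \<psi>' t)" by (rule polynomial_map_compose[OF pM \<psi>'])
  have "\<exists>s. polynomial_fun s \<and> \<not> zero_on UNIV s \<and>
      (\<forall>t v. s t \<noteq> 0 \<longrightarrow> (\<forall>j. dderiv (\<lambda>t. (M *v \<psi>' t) $ j) t v = 0) \<longrightarrow> dderiv (\<lambda>t. \<psi>' t $ l) t v = 0)" for l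
  proof -
    have "polynomial_fun (\<lambda>t. \<psi>' t $ l)" using \<psi>' by (simp add: polynomial_map_def)
    then show ?thesis
      by (rule algebraic_on_kernel[OF h _ alg[of l]]) blast
  qed
  then obtain s where s: "\<And>l. polynomial_fun (s l)" "\<And>l. \<not> zero_on UNIV (s l)"
    "\<And>l t v. s l t \<noteq> 0 \<Longrightarrow> \<forall>j. dderiv (\<lambda>t. (M *v \<psi>' t) $ j) t v = 0 \<Longrightarrow> dderiv (\<lambda>t. \<psi>' t $ l) t v = 0"
    by metis
  obtain r where r: "polynomial_fun r" "r t1 \<noteq> 0"
    "\<And>t. r t \<noteq> 0 \<Longrightarrow> nullity (jacobian \<psi>' (at t)) \<le> nullity (jacobian \<psi>' (at t1))"
    using generic_nullity[of "\<lambda>t. jacobian \<psi>' (at t)" t1, OF polynomial_fun_jacobian[OF \<psi>']] by metis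
  have "(\<lambda>t. \<Prod>l\<in>UNIV. s l t) \<in> Collect polynomial_fun \<and> \<not> zero_on UNIV (\<lambda>t. \<Prod>l\<in>UNIV. s l t)"
    by (rule prod_nonzero) (use s(1,2) in auto)
  moreover have "\<not> zero_on UNIV r" using r(2) by (auto simp: zero_on_def)
  ultimately have "\<not> zero_on UNIV (r * (\<lambda>t. \<Prod>l\<in>UNIV. s l t))"
    using no_zero_divisors[of r "\<lambda>t. \<Prod>l\<in>UNIV. s l t"] r(1) by auto
  then obtain t where t: "r t \<noteq> 0" "\<And>l. s l t \<noteq> 0" by (auto simp: zero_on_def)
  have "nullity (jacobian (\<lambda>t. M *v \<psi>' t) (at t)) \<le> nullity (jacobian \<psi>' (at t))"
    by (rule nullity_mono) (use s(3)[OF t(2)] in \<open>simp add: jacobian_mult_eq_0[OF h] jacobian_mult_eq_0[OF \<psi>']\<close>)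
  also have "\<dots> < nullity (jacobian \<psi> (at t0))" using r(3)[OF t(1)] less by simp
  finally have "nullity (jacobian (\<lambda>t. M *v \<psi>' t) (at t)) < nullity (jacobian \<psi> (at t0))" .
  moreover have "vec.dim (range ((*v) (jacobian (\<lambda>t. M *v \<psi>' t) (at t)))) \<le> vec.dim ?V"
    using M(2) by (intro vec.dim_subset) (auto simp: jacobian_compose[OF pM \<psi>'] JM)
  ultimately show False
    using dim_range_plus_nullity[of "jacobian (\<lambda>t. M *v \<psi>' t) (at t)"]
      dim_range_plus_nullity[of "jacobian \<psi> (at t0)"] by linarith
qed

text \<open>Choose vectors \<open>w j\<close> mapped by \<open>d\<phi>\<close> at \<open>t0\<close> to a basis of its range. With \<open>L i\<close> a projection onto the span \<open>V i\<close> of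
the first \<open>i\<close> of them, \<open>\<psi> i\<close> parametrizes the image of the affine subspace \<open>t0 + V i\<close>. Its rank is at
most \<open>i\<close> everywhere and equal to \<open>i\<close> at \<open>0\<close>, so the closures of these images form a strict chain.\<close>

lemma rank_le_variety_dim:
  fixes \<phi> :: "'k::real_normed_field ^ 'l \<Rightarrow> 'k ^ 'n"
  assumes \<phi>: "polynomial_map \<phi>"
  shows "enat (rank (jacobian \<phi> (at t0))) \<le> variety_dim (range \<phi>)"
proof -
  let ?J = "jacobian \<phi> (at t0)"
  define e where "e = rank ?J"
  have e: "e = vec.dim (range ((*v) ?J))"
    using rank_plus_nullity[of ?J] dim_range_plus_nullity[of ?J] by (simp add: e_def)
  have e_le: "e \<le> CARD('l)" using rank_plus_nullity[of ?J] by (simp add: e_def)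
  obtain B where B: "B \<subseteq> range ((*v) ?J)" "vec.independent B" "card B = e"
    using vec.basis_exists[of "range ((*v) ?J)"] e by metis
  have "finite B" using B(2) by (rule vec.finiteI_independent)
  then obtain b where b: "bij_betw b {0..<e} B"
    using ex_bij_betw_nat_finite[of B] B(3) by blast
  have "\<forall>j<e. \<exists>w. ?J *v w = b j" using b B(1) by (fastforce simp: bij_betw_def)
  then obtain w where w: "\<And>j. j < e \<Longrightarrow> ?J *v w j = b j" by metis
  define V where "V i = vec.span (w ` {..<i})" for i
  have dimV: "vec.dim (V i) \<le> i" for i
    using vec.dim_le_card[of "V i" "w ` {..<i}"] card_image_le[of "{..<i}" w] by (simp add: V_def)
  have V_mono: "V i \<subseteq> V (Suc i)" for i
    unfolding V_def by (intro vec.span_mono) auto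
  have "\<forall>i. \<exists>M :: 'k ^ 'l ^ 'l. (\<forall>v\<in>V i. M *v v = v) \<and> (\<forall>v. M *v v \<in> V i)"
    using exists_projection[of "V _"] unfolding V_def by (metis vec.subspace_span)
  then obtain L :: "nat \<Rightarrow> 'k ^ 'l ^ 'l" where L: "\<And>i v. v \<in> V i \<Longrightarrow> L i *v v = v" "\<And>i v. L i *v v \<in> V i"
    by metis
  define \<psi> where "\<psi> i t = \<phi> (t0 + L i *v t)" for i t
  have \<psi>: "polynomial_map (\<psi> i)" for i
    unfolding \<psi>_def by (intro polynomial_map_compose[OF \<phi>] polynomial_map_affine)
  have J\<psi>: "jacobian (\<psi> i) (at t) *v v = jacobian \<phi> (at (t0 + L i *v t)) *v (L i *v v)" for i t v
    unfolding \<psi>_def jacobian_compose[OF \<phi> polynomial_map_affine] jacobian_affine ..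
  have lower: "CARD('l) - i \<le> nullity (jacobian (\<psi> i) (at t))" for i t
  proof -
    have "vec.dim (range ((*v) (L i))) \<le> vec.dim (V i)"
      using L(2) by (intro vec.dim_subset) auto
    then have "CARD('l) - i \<le> nullity (L i)"
      using dim_range_plus_nullity[of "L i"] dimV[of i] by linarith
    also have "\<dots> \<le> nullity (jacobian (\<psi> i) (at t))"
      by (rule nullity_mono) (simp add: J\<psi>)
    finally show ?thesis .
  qed
  have upper: "nullity (jacobian (\<psi> i) (at 0)) \<le> CARD('l) - i" if i: "i \<le> e" for i
  proof -
    have "b ` {..<i} \<subseteq> range ((*v) (jacobian (\<psi> i) (at 0)))"
    proof
      fix y assume "y \<in> b ` {..<i}"
      then obtain j where j: "j < i" "y = b j" by auto
      then have "w j \<in> V i" unfolding V_def by (intro vec.span_base) auto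
      then have "jacobian (\<psi> i) (at 0) *v w j = y"
        using w[of j] j i by (simp add: J\<psi> L(1))
      then show "y \<in> range ((*v) (jacobian (\<psi> i) (at 0)))" by (metis rangeI)
    qed
    moreover have "vec.independent (b ` {..<i})"
      using B(2) b i by (intro vec.independent_mono[OF B(2)]) (auto simp: bij_betw_def)
    ultimately have "card (b ` {..<i}) \<le> vec.dim (range ((*v) (jacobian (\<psi> i) (at 0))))"
      by (rule vec.independent_card_le_dim)
    moreover have "card (b ` {..<i}) = i"
      using b i by (subst card_image) (auto simp: bij_betw_def intro: inj_on_subset)
    ultimately show ?thesis
      using dim_range_plus_nullity[of "jacobian (\<psi> i) (at 0)"] by linarith
  qed
  define C where "C i = zariski_closure (range (\<psi> i))" for i
  have sub: "range (\<psi> i) \<subseteq> range (\<psi> (Suc i))" for i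
  proof
    fix y assume "y \<in> range (\<psi> i)"
    then obtain t where "y = \<phi> (t0 + L i *v t)" by (auto simp: \<psi>_def)
    also have "\<dots> = \<psi> (Suc i) (L i *v t)"
      using L(1)[of "L i *v t" "Suc i"] L(2)[of i t] V_mono[of i] by (auto simp: \<psi>_def)
    finally show "y \<in> range (\<psi> (Suc i))" by blast
  qed
  have mono: "zariski_closure A \<subseteq> zariski_closure A'" if "A \<subseteq> A'" for A A' :: "('k ^ 'n) set"
    using that zariski_closure_facts(2)[of A'] by (intro zariski_closure_facts) auto
  have "\<forall>i\<le>e. irreducible_variety (C i)"
    unfolding C_def using irreducible_closure_range[OF \<psi>] by blast
  moreover have "\<forall>i<e. C i \<subset> C (Suc i)"
  proof (intro allI impI psubsetI)
    fix i assume i: "i < e"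
    show "C i \<subseteq> C (Suc i)" unfolding C_def by (rule mono[OF sub])
    show "C i \<noteq> C (Suc i)"
      unfolding C_def
    proof (rule closure_neq_if_nullity[OF \<psi> \<psi> sub])
      show "nullity (jacobian (\<psi> i) (at 0)) \<le> nullity (jacobian (\<psi> i) (at t))" for t
        using upper[of i] lower[of i t] i by simp
      show "nullity (jacobian (\<psi> (Suc i)) (at 0)) < nullity (jacobian (\<psi> i) (at 0))"
        using upper[of "Suc i"] lower[of i 0] i e_le by simp
    qed
  qed
  moreover have "C e \<subseteq> zariski_closure (range \<phi>)"
    unfolding C_def by (rule mono) (auto simp: \<psi>_def)
  ultimately show ?thesis
    unfolding variety_dim_def e_def[symmetric] by (intro Sup_upper) blast
qed

theorem mainTheorem6:
  fixes \<mu> :: "'k::real_normed_field ^ 'n \<Rightarrow> 'k ^ 's"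
    and X :: "('k ^ 'n) set"
    and f :: "'k ^ 'n \<Rightarrow> 'k ^ 'm"
    and \<phi> :: "'k ^ 'l \<Rightarrow> 'k ^ 'n"
  assumes "polynomial_map \<mu>"
  shows
    "(polynomial_map f \<and> X = {x. f x = 0} \<and> irreducible_variety X \<longrightarrow>
        (\<forall>x\<in>X. ker_differential \<mu> x \<inter> ker_differential f x = {0} \<longleftrightarrow>
               rank (stack_matrix (jacobian \<mu> (at x)) (jacobian f (at x))) = CARD('n)) \<and>
        ((\<exists>x\<in>X. ker_differential \<mu> x \<inter> ker_differential f x = {0}) \<longrightarrow>
           generically_recoverable \<mu> X)) \<and>
     (polynomial_map \<phi> \<and> X = range \<phi> \<and>
        (\<exists>t. enat (rank (jacobian (\<mu> \<circ> \<phi>) (at t))) = variety_dim X) \<longrightarrow>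
        generically_recoverable \<mu> X)"
proof (intro conjI impI ballI)
  fix x
  let ?A = "stack_matrix (jacobian \<mu> (at x)) (jacobian f (at x))"
  have ker: "ker_differential \<mu> x \<inter> ker_differential f x = {v. ?A *v v = 0}"
    by (auto simp: ker_differential_def stack_matrix_mult_eq_0)
  have "{v. ?A *v v = 0} = {0} \<longleftrightarrow> nullity ?A = 0"
    unfolding nullity_def by (subst vec.dim_eq_0) auto
  also have "\<dots> \<longleftrightarrow> rank ?A = CARD('n)"
    using rank_plus_nullity[of ?A] by linarith
  finally show "ker_differential \<mu> x \<inter> ker_differential f x = {0} \<longleftrightarrow> rank ?A = CARD('n)"
    unfolding ker .
next
  assume "polynomial_map f \<and> X = {x. f x = 0} \<and> irreducible_variety X"
  then have f: "polynomial_map f" and X: "X = {x. f x = 0}" "irreducible_variety X" by auto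
  assume "\<exists>x\<in>X. ker_differential \<mu> x \<inter> ker_differential f x = {0}"
  then obtain x0 where x0: "x0 \<in> X" "ker_differential \<mu> x0 \<inter> ker_differential f x0 = {0}" by blast
  interpret function_domain X "Collect polynomial_fun"
    by (rule function_domain_irreducible[OF X(2)])
  let ?A = "\<lambda>x. stack_matrix (jacobian \<mu> (at x)) (jacobian f (at x))"
  have ent: "polynomial_fun (\<lambda>x. ?A x $ i $ j)" for i j
    by (cases i) (simp_all add: stack_matrix_def polynomial_fun_jacobian assms f)
  have inj: "v = 0" if "?A x0 *v v = 0" for v
    using that x0(2) by (auto simp: stack_matrix_mult_eq_0 ker_differential_def)
  obtain s where s: "polynomial_fun s" "s x0 \<noteq> 0" "\<And>x v. s x \<noteq> 0 \<Longrightarrow> ?A x *v v = 0 \<Longrightarrow> v = 0"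
    using generic_injective[of ?A x0, OF ent inj] by metis
  have "algebraic_on X (pullback (\<lambda>x. \<mu> x)) (\<lambda>x. x $ l)" for l
  proof (rule algebraic_on_vector_field)
    show "function_domain X (Collect polynomial_fun)" by (rule function_domain_irreducible[OF X(2)])
    fix v :: "'k ^ 'n \<Rightarrow> 'k ^ 'n"
    assume v: "polynomial_map v"
      and tan: "\<And>p x. polynomial_fun p \<Longrightarrow> zero_on X p \<Longrightarrow> x \<in> X \<Longrightarrow> dderiv p x (v x) = 0"
      and \<mu>v: "\<And>j x. x \<in> X \<Longrightarrow> dderiv (\<lambda>x. \<mu> x $ j) x (v x) = 0"
    have "v x = 0" if x: "x \<in> X" "s x \<noteq> 0" for x
    proof (rule s(3)[OF x(2)])
      have "dderiv (\<lambda>x. f x $ j) x (v x) = 0" for j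
        using f X(1) x(1) by (intro tan) (auto simp: polynomial_map_def zero_on_def)
      with \<mu>v[OF x(1)] show "?A x *v v x = 0"
        by (simp add: stack_matrix_mult_eq_0 jacobian_mult_eq_0 assms f)
    qed
    then have "s x * v x $ l = 0" if "x \<in> X" for x
      using that by (cases "s x = 0") auto
    then have "zero_on X (s * (\<lambda>x. v x $ l))" by (simp add: zero_on_def)
    moreover have "\<not> zero_on X s" using s(2) x0(1) by (auto simp: zero_on_def)
    ultimately have "zero_on X (\<lambda>x. v x $ l)"
      using no_zero_divisors[of s "\<lambda>x. v x $ l"] s(1) v by (simp add: polynomial_map_def)
    then show "zero_on X (\<lambda>x. dderiv (\<lambda>x. x $ l) x (v x))" by simp
  qed (use assms polynomial_fun_coord in auto)
  then have "generically_recoverable \<mu> ((\<lambda>x. x) ` X)"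
    using assms by (intro generically_recoverableI function_domain_irreducible X polynomial_map_id)
  then show "generically_recoverable \<mu> X" by simp
next
  assume "polynomial_map \<phi> \<and> X = range \<phi> \<and>
    (\<exists>t. enat (rank (jacobian (\<mu> \<circ> \<phi>) (at t))) = variety_dim X)"
  then obtain t0 where \<phi>: "polynomial_map \<phi>" and X: "X = range \<phi>"
    and t0: "enat (rank (jacobian (\<lambda>t. \<mu> (\<phi> t)) (at t0))) = variety_dim X"
    by (auto simp: o_def)
  have "nullity (jacobian (\<lambda>t. \<mu> (\<phi> t)) (at t0)) \<le> nullity (jacobian \<phi> (at t))" for t
  proof -
    have "rank (jacobian \<phi> (at t)) \<le> rank (jacobian (\<lambda>t. \<mu> (\<phi> t)) (at t0))"
      using rank_le_variety_dim[OF \<phi>, of t] t0 X by (metis enat_ord_simps(1))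
    then show ?thesis
      using rank_plus_nullity[of "jacobian \<phi> (at t)"] rank_plus_nullity[of "jacobian (\<lambda>t. \<mu> (\<phi> t)) (at t0)"]
      by linarith
  qed
  then show "generically_recoverable \<mu> X"
    unfolding X by (intro generically_recoverableI function_domain_UNIV \<phi> assms algebraic_on_generic_kernel)
qed

end
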